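(* Let $m\ge 2$. The map $\psi:\tilde{y}(m)\to Pin(V,q)$ given on the generators of $\tilde{y}(m)$ by \[ \tau\mapsto u,\qquad a\mapsto s\,u v_1,\qquad \tilde{s}_i\mapsto v_i+v_{i+1}\quad(1\le i\le m-1) \] defines a group homomorphism.
   Context: Conventions: $x^y=y^{-1}xy$, $[x,y]=x^{-1}y^{-1}xy$. $S_m$ is the symmetric group on $\{1,\dots,m\}$ and $s_i=(i,i+1)$. The group $y(m)=\langle a, S_m \mid [s_1,s_1^{a^k}]=1 \text{ for all } k\in\mathbb{Z},\ a^{s_i}=a^{-1} \text{ for } 2\le i\le m-1\rangle$ (quotient of the free product of $\langle a\rangle\cong\mathbb{Z}$ and $S_m$). $\tilde{y}(m)=y(m)\langle\tau\rangle$ is the semidirect product with an involution $\tau$ acting on $y(m)$ by inverting $a$ and centralising $S_m$. Put $\tilde{s}_i=\tau s_i$. $R=\mathbb{F}_2[s,s^{-1}]$ with $s$ an indeterminate, $t=s^2$. $V$ is the free $R$-module with basis $u,v_1,\dots,v_m$. The symplectic (alternating) bilinear form $(\cdot,\cdot)$ on $V$ is given by $(u,v_i)=(v_i,v_j)=1$ for all $i$ and all $j\neq i$, and $q$ is the quadratic form with associated bilinear form $(\cdot,\cdot)$ and $q(u)=1$, $q(v_1)=\dots=q(v_m)=t^{-1}$. $Cl=Cl(V,q)$ is the Clifford algebra, the quotient of the tensor algebra $T(V)$ by the ideal generated by the relations $w^2=q(w)$, $w\in V$; $V$ and $R$ are regarded as subsets of $Cl$. $x\mapsto\overline{x}$ is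 the anti-automorphism of $Cl$ reversing products of vectors. The Clifford group is $C(V,q)=\{c\in Cl^\times : c^{-1}vc\in V \text{ for all } v\in V\}$ and $Pin(V,q)=\{c\in C(V,q): c\overline{c}=1\}$. *)

theory Defs
  imports
    "HOL-Algebra.QuotRing"
    "HOL-Algebra.Sym_Groups"
    "HOL-Algebra.Elementary_Groups"
    "HOL-Library.Poly_Mapping"
    "HOL-Library.Z2"
begin

section \<open>Free products, presentations and semidirect products\<close>

text \<open>
  Words over the disjoint union of the carriers, modulo the congruence generated by multiplying
  adjacent letters from the same factor and deleting identity letters.
\<close>

definition fp_words :: "('a, 'c) monoid_scheme \<Rightarrow> ('b, 'd) monoid_scheme \<Rightarrow> ('a + 'b) list set"
  where "fp_words G H = lists (Inl ` carrier G \<union> Inr ` carrier H)"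

inductive fp_eq :: "('a, 'c) monoid_scheme \<Rightarrow> ('b, 'd) monoid_scheme \<Rightarrow> ('a + 'b) list \<Rightarrow> ('a + 'b) list \<Rightarrow> bool"
  for G H where
  refl: "w \<in> fp_words G H \<Longrightarrow> fp_eq G H w w"
| sym: "fp_eq G H w w' \<Longrightarrow> fp_eq G H w' w"
| trans: "fp_eq G H w w' \<Longrightarrow> fp_eq G H w' w'' \<Longrightarrow> fp_eq G H w w''"
| mult_left: "u \<in> fp_words G H \<Longrightarrow> w \<in> fp_words G H \<Longrightarrow>
    x \<in> carrier G \<Longrightarrow> y \<in> carrier G \<Longrightarrow> fp_eq G H (u @ [Inl x, Inl y] @ w) (u @ [Inl (x \<otimes>\<^bsub>G\<^esub> y)] @ w)"
| mult_right: "u \<in> fp_words G H \<Longrightarrow> w \<in> fp_words G H \<Longrightarrow>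
    x \<in> carrier H \<Longrightarrow> y \<in> carrier H \<Longrightarrow> fp_eq G H (u @ [Inr x, Inr y] @ w) (u @ [Inr (x \<otimes>\<^bsub>H\<^esub> y)] @ w)"
| one_left: "u \<in> fp_words G H \<Longrightarrow> w \<in> fp_words G H \<Longrightarrow>
    fp_eq G H (u @ [Inl \<one>\<^bsub>G\<^esub>] @ w) (u @ w)"
| one_right: "u \<in> fp_words G H \<Longrightarrow> w \<in> fp_words G H \<Longrightarrow>
    fp_eq G H (u @ [Inr \<one>\<^bsub>H\<^esub>] @ w) (u @ w)"

definition fp_class :: "('a, 'c) monoid_scheme \<Rightarrow> ('b, 'd) monoid_scheme \<Rightarrow> ('a + 'b) list \<Rightarrow> ('a + 'b) list set"
  where "fp_class G H w = {w'. fp_eq G H w w'}"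

definition free_product :: "('a, 'c) monoid_scheme \<Rightarrow> ('b, 'd) monoid_scheme \<Rightarrow> ('a + 'b) list set monoid"
  where "free_product G H =
    \<lparr>carrier = fp_class G H ` fp_words G H,
     monoid.mult = (\<lambda>X Y. \<Union>x\<in>X. \<Union>y\<in>Y. fp_class G H (x @ y)),
     one = fp_class G H []\<rparr>"

definition normal_closure :: "('a, 'c) monoid_scheme \<Rightarrow> 'a set \<Rightarrow> 'a set"
  where "normal_closure G S = \<Inter>{N. N \<lhd> G \<and> S \<subseteq> N}"

definition conjg :: "('a, 'c) monoid_scheme \<Rightarrow> 'a \<Rightarrow> 'a \<Rightarrow> 'a"
  where "conjg G x y = inv\<^bsub>G\<^esub> y \<otimes>\<^bsub>G\<^esub> x \<otimes>\<^bsub>G\<^esub> y"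

definition commutator :: "('a, 'c) monoid_scheme \<Rightarrow> 'a \<Rightarrow> 'a \<Rightarrow> 'a"
  where "commutator G x y = inv\<^bsub>G\<^esub> x \<otimes>\<^bsub>G\<^esub> inv\<^bsub>G\<^esub> y \<otimes>\<^bsub>G\<^esub> x \<otimes>\<^bsub>G\<^esub> y"

definition semidirect_product ::
    "('a, 'c) monoid_scheme \<Rightarrow> ('b, 'd) monoid_scheme \<Rightarrow> ('b \<Rightarrow> 'a \<Rightarrow> 'a) \<Rightarrow> ('a \<times> 'b) monoid"
  where "semidirect_product G K \<phi> =
    \<lparr>carrier = carrier G \<times> carrier K,
     monoid.mult = (\<lambda>(g, k) (h, l). (g \<otimes>\<^bsub>G\<^esub> \<phi> k h, k \<otimes>\<^bsub>K\<^esub> l)),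
     one = (\<one>\<^bsub>G\<^esub>, \<one>\<^bsub>K\<^esub>)\<rparr>"

section \<open>The groups $y(m)$ and $\tilde y(m)$\<close>

text \<open>
  The product of \<^const>\<open>sym_group\<close> is composition of maps; the opposite convention gives an
  isomorphic group via inversion, which fixes the generators $s_i$.
\<close>

abbreviation y_free :: "nat \<Rightarrow> (int + (nat \<Rightarrow> nat)) list set monoid"
  where "y_free m \<equiv> free_product integer_group (sym_group m)"

definition free_a :: "nat \<Rightarrow> (int + (nat \<Rightarrow> nat)) list set"
  where "free_a m = fp_class integer_group (sym_group m) [Inl 1]"

definition free_s :: "nat \<Rightarrow> nat \<Rightarrow> (int + (nat \<Rightarrow> nat)) list set"
  where "free_s m i = fp_class integer_group (sym_group m) [Inr (transpose i (Suc i))]"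

text \<open>The relation $a^{s_i} = a^{-1}$ is rendered by the relator $a^{s_i} a$.\<close>

definition y_relators :: "nat \<Rightarrow> (int + (nat \<Rightarrow> nat)) list set set"
  where "y_relators m =
    {commutator (y_free m) (free_s m 1) (conjg (y_free m) (free_s m 1) (free_a m [^]\<^bsub>y_free m\<^esub> k)) | k :: int. True}
    \<union> {conjg (y_free m) (free_a m) (free_s m i) \<otimes>\<^bsub>y_free m\<^esub> free_a m | i. 2 \<le> i \<and> i \<le> m - 1}"

definition y_kernel :: "nat \<Rightarrow> (int + (nat \<Rightarrow> nat)) list set set"
  where "y_kernel m = normal_closure (y_free m) (y_relators m)"

definition y_group :: "nat \<Rightarrow> (int + (nat \<Rightarrow> nat)) list set set monoid"
  where "y_group m = y_free m Mod y_kernel m"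

definition y_a :: "nat \<Rightarrow> (int + (nat \<Rightarrow> nat)) list set set"
  where "y_a m = y_kernel m #>\<^bsub>y_free m\<^esub> free_a m"

definition y_s :: "nat \<Rightarrow> nat \<Rightarrow> (int + (nat \<Rightarrow> nat)) list set set"
  where "y_s m i = y_kernel m #>\<^bsub>y_free m\<^esub> free_s m i"

text \<open>
  The automorphism inverting $a$ and centralising $S_m$: it negates the exponents of $a$ in every
  word of every class of every coset; see \<open>tau_aut_hom\<close>, \<open>tau_aut_invol\<close>, \<open>tau_aut_y_a\<close>,
  \<open>tau_aut_y_s\<close>.
\<close>

definition tau_word :: "(int + (nat \<Rightarrow> nat)) list \<Rightarrow> (int + (nat \<Rightarrow> nat)) list"
  where "tau_word = map (map_sum uminus id)"

definition tau_aut :: "(int + (nat \<Rightarrow> nat)) list set set \<Rightarrow> (int + (nat \<Rightarrow> nat)) list set set"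
  where "tau_aut = (`) ((`) tau_word)"

definition yt_group :: "nat \<Rightarrow> ((int + (nat \<Rightarrow> nat)) list set set \<times> int) monoid"
  where "yt_group m = semidirect_product (y_group m) (integer_mod_group 2) (\<lambda>e. if e = 1 then tau_aut else id)"

definition yt_tau :: "nat \<Rightarrow> (int + (nat \<Rightarrow> nat)) list set set \<times> int"
  where "yt_tau m = (\<one>\<^bsub>y_group m\<^esub>, 1)"

definition yt_a :: "nat \<Rightarrow> (int + (nat \<Rightarrow> nat)) list set set \<times> int"
  where "yt_a m = (y_a m, 0)"

definition yt_s :: "nat \<Rightarrow> nat \<Rightarrow> (int + (nat \<Rightarrow> nat)) list set set \<times> int"
  where "yt_s m i = (y_s m i, 0)"

definition yt_st :: "nat \<Rightarrow> nat \<Rightarrow> (int + (nat \<Rightarrow> nat)) list set set \<times> int"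
  where "yt_st m i = yt_tau m \<otimes>\<^bsub>yt_group m\<^esub> yt_s m i"

lemma fp_words_simps [simp]:
  "[] \<in> fp_words G H"
  "Inl x # w \<in> fp_words G H \<longleftrightarrow> x \<in> carrier G \<and> w \<in> fp_words G H"
  "Inr y # w \<in> fp_words G H \<longleftrightarrow> y \<in> carrier H \<and> w \<in> fp_words G H"
  "u @ w \<in> fp_words G H \<longleftrightarrow> u \<in> fp_words G H \<and> w \<in> fp_words G H"
  by (auto simp: fp_words_def)

lemma fp_eq_lists:
  "fp_eq G H w w' \<Longrightarrow> group G \<Longrightarrow> group H \<Longrightarrow>
    w \<in> fp_words G H \<and> w' \<in> fp_words G H"
  by (induction rule: fp_eq.induct) (simp_all add: group.is_monoid monoid.one_closed monoid.m_closed)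

declare fp_eq.trans [trans]

lemma fp_eq_append_right:
  assumes "fp_eq G H w w'" "v \<in> fp_words G H"
  shows "fp_eq G H (w @ v) (w' @ v)"
  using assms
proof (induction rule: fp_eq.induct)
  case (mult_left u w x y)
  then show ?case using fp_eq.mult_left[of u G H "w @ v" x y] by simp
next
  case (mult_right u w x y)
  then show ?case using fp_eq.mult_right[of u G H "w @ v" x y] by simp
next
  case (one_left u w)
  then show ?case using fp_eq.one_left[of u G H "w @ v"] by simp
next
  case (one_right u w)
  then show ?case using fp_eq.one_right[of u G H "w @ v"] by simp
next
  case (refl w)
  then show ?case by (simp add: fp_eq.refl)
next
  case (sym w w')
  then show ?case by (simp add: fp_eq.sym)
next
  case (trans w w' w'')
  then show ?case by (blast intro: fp_eq.trans)
qed

lemma fp_eq_append_left: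
  assumes "fp_eq G H w w'" "v \<in> fp_words G H"
  shows "fp_eq G H (v @ w) (v @ w')"
  using assms
proof (induction rule: fp_eq.induct)
  case (mult_left u w x y)
  then show ?case using fp_eq.mult_left[of "v @ u" G H w x y] by simp
next
  case (mult_right u w x y)
  then show ?case using fp_eq.mult_right[of "v @ u" G H w x y] by simp
next
  case (one_left u w)
  then show ?case using fp_eq.one_left[of "v @ u" G H w] by simp
next
  case (one_right u w)
  then show ?case using fp_eq.one_right[of "v @ u" G H w] by simp
next
  case (refl w)
  then show ?case by (simp add: fp_eq.refl)
next
  case (sym w w')
  then show ?case by (simp add: fp_eq.sym)
next
  case (trans w w' w'')
  then show ?case by (blast intro: fp_eq.trans)
qed

lemma fp_class_eqI: "fp_eq G H w w' \<Longrightarrow> fp_class G H w = fp_class G H w'"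
  unfolding fp_class_def using fp_eq.sym fp_eq.trans by blast

lemma fp_class_eq_iff:
  "w \<in> fp_words G H \<Longrightarrow> w' \<in> fp_words G H \<Longrightarrow>
    fp_class G H w = fp_class G H w' \<longleftrightarrow> fp_eq G H w w'"
  using fp_class_eqI[of G H w w'] fp_eq.refl[of w' G H] by (auto simp: fp_class_def)

lemma free_product_mult:
  assumes "group G" "group H"
    "w \<in> fp_words G H" "w' \<in> fp_words G H"
  shows "fp_class G H w \<otimes>\<^bsub>free_product G H\<^esub> fp_class G H w' = fp_class G H (w @ w')"
proof -
  have "fp_class G H (x @ y) = fp_class G H (w @ w')" if "fp_eq G H w x" "fp_eq G H w' y" for x y
  proof -
    have "fp_eq G H (w @ w') (x @ w')" using that(1) assms(4) by (rule fp_eq_append_right)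
    moreover have "fp_eq G H (x @ w') (x @ y)"
      using fp_eq_append_left[OF that(2)] fp_eq_lists[OF that(1) assms(1,2)] by simp
    ultimately show ?thesis using fp_class_eqI fp_eq.trans by metis
  qed
  moreover have "w \<in> fp_class G H w" "w' \<in> fp_class G H w'"
    using assms fp_eq.refl by (auto simp: fp_class_def)
  ultimately have "(\<Union>x\<in>fp_class G H w. \<Union>y\<in>fp_class G H w'. fp_class G H (x @ y)) = fp_class G H (w @ w')"
    unfolding fp_class_def[of G H w] fp_class_def[of G H w'] by blast
  then show ?thesis unfolding free_product_def by simp
qed

lemma free_product_group:
  assumes "group G" "group H"
  shows "group (free_product G H)"
proof -
  interpret G: group G by fact
  interpret H: group H by fact
  let ?L = "fp_words G H"
  have inv: "\<exists>w'\<in>?L. fp_eq G H (w' @ w) []" if "w \<in> ?L" for w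
    using that
  proof (induction w)
    case Nil
    then show ?case using fp_eq.refl[of "[]" G H] by (intro bexI[of _ "[]"]) auto
  next
    case (Cons z w)
    then obtain w' where w': "w' \<in> ?L" "fp_eq G H (w' @ w) []" by (cases z) (simp_all, blast+)
    have w: "w \<in> ?L" using Cons by (cases z) auto
    show ?case
    proof (cases z)
      case (Inl x)
      then have x: "x \<in> carrier G" using Cons by auto
      have "fp_eq G H (w' @ [Inl (inv\<^bsub>G\<^esub> x), Inl x] @ w) (w' @ [Inl \<one>\<^bsub>G\<^esub>] @ w)"
        using fp_eq.mult_left[of w' G H w "inv\<^bsub>G\<^esub> x" x] w' w x by simp
      also have "fp_eq G H (w' @ [Inl \<one>\<^bsub>G\<^esub>] @ w) (w' @ w)" using w' w by (intro fp_eq.one_left)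
      also note w'(2)
      finally have "fp_eq G H ((w' @ [Inl (inv\<^bsub>G\<^esub> x)]) @ z # w) []"
        using Inl by simp
      then show ?thesis using w' x by (intro bexI[of _ "w' @ [Inl (inv\<^bsub>G\<^esub> x)]"]) auto
    next
      case (Inr x)
      then have x: "x \<in> carrier H" using Cons by auto
      have "fp_eq G H (w' @ [Inr (inv\<^bsub>H\<^esub> x), Inr x] @ w) (w' @ [Inr \<one>\<^bsub>H\<^esub>] @ w)"
        using fp_eq.mult_right[of w' G H w "inv\<^bsub>H\<^esub> x" x] w' w x by simp
      also have "fp_eq G H (w' @ [Inr \<one>\<^bsub>H\<^esub>] @ w) (w' @ w)" using w' w by (intro fp_eq.one_right)
      also note w'(2)
      finally have "fp_eq G H ((w' @ [Inr (inv\<^bsub>H\<^esub> x)]) @ z # w) []"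
        using Inr by simp
      then show ?thesis using w' x by (intro bexI[of _ "w' @ [Inr (inv\<^bsub>H\<^esub> x)]"]) auto
    qed
  qed
  have carr: "carrier (free_product G H) = fp_class G H ` ?L" by (simp add: free_product_def)
  have one: "\<one>\<^bsub>free_product G H\<^esub> = fp_class G H []" by (simp add: free_product_def)
  have mult: "fp_class G H w \<otimes>\<^bsub>free_product G H\<^esub> fp_class G H w' = fp_class G H (w @ w')"
    if "w \<in> ?L" "w' \<in> ?L" for w w' using free_product_mult[OF assms that] .
  show ?thesis
  proof (rule groupI, goal_cases)
    case (1 X Y)
    then obtain x y where "x \<in> ?L" "X = fp_class G H x" "y \<in> ?L" "Y = fp_class G H y" unfolding carr by blast
    then show ?case unfolding carr by (simp add: mult)
  next
    case 2 then show ?case unfolding carr one by simp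
  next
    case (3 X Y Z)
    then obtain x y z where "x \<in> ?L" "X = fp_class G H x" "y \<in> ?L" "Y = fp_class G H y"
      "z \<in> ?L" "Z = fp_class G H z" unfolding carr by blast
    then show ?case by (simp add: mult)
  next
    case (4 X)
    then obtain x where "x \<in> ?L" "X = fp_class G H x" unfolding carr by blast
    then show ?case unfolding one by (simp add: mult)
  next
    case (5 X) then obtain w where w: "w \<in> ?L" "X = fp_class G H w" unfolding carr by blast
    obtain w' where w': "w' \<in> ?L" "fp_eq G H (w' @ w) []" using inv[OF w(1)] by blast
    have "fp_class G H w' \<otimes>\<^bsub>free_product G H\<^esub> X = \<one>\<^bsub>free_product G H\<^esub>"
      unfolding one w(2) mult[OF w'(1) w(1)] by (rule fp_class_eqI[OF w'(2)])
    then show ?case unfolding carr using w'(1) by blast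
  qed
qed

lemma normal_closure_normal:
  assumes "group G" "S \<subseteq> carrier G"
  shows "normal_closure G S \<lhd> G"
proof -
  interpret group G by fact
  have "carrier G \<lhd> G" unfolding normal_inv_iff by (simp add: subgroup_self)
  then have ne: "carrier G \<in> {N. N \<lhd> G \<and> S \<subseteq> N}" using assms by simp
  have "subgroup (normal_closure G S) G" unfolding normal_closure_def
    by (rule subgroups_Inter) (use ne normal_imp_subgroup in blast)+
  moreover have "x \<otimes>\<^bsub>G\<^esub> h \<otimes>\<^bsub>G\<^esub> inv\<^bsub>G\<^esub> x \<in> normal_closure G S"
    if "x \<in> carrier G" "h \<in> normal_closure G S" for x h
    using that unfolding normal_closure_def by (blast intro: normal.inv_op_closed2)
  ultimately show ?thesis
    unfolding normal_inv_iff by blast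
qed

lemma normal_closure_superset: "S \<subseteq> normal_closure G S"
  by (auto simp: normal_closure_def)

lemma normal_closure_least: "N \<lhd> G \<Longrightarrow> S \<subseteq> N \<Longrightarrow> normal_closure G S \<subseteq> N"
  by (auto simp: normal_closure_def)

lemma y_free_group: "group (y_free m)"
  by (simp add: free_product_group sym_group_is_group)

lemma sym_group_is_group' [simp]: "group (sym_group m)"
  by (rule sym_group_is_group)

lemma tau_word_tau_word [simp]: "tau_word (tau_word w) = w"
  by (simp add: tau_word_def comp_def sum.map_comp sum.map_ident map_idI sum.map_id)

lemma tau_word_simps [simp]:
  "tau_word [] = []"
  "tau_word (Inl k # w) = Inl (- k) # tau_word w"
  "tau_word (Inr p # w) = Inr p # tau_word w"
  "tau_word (u @ w) = tau_word u @ tau_word w"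
  by (simp_all add: tau_word_def)

lemma tau_word_in_words:
  "w \<in> fp_words integer_group (sym_group m) \<Longrightarrow> tau_word w \<in> fp_words integer_group (sym_group m)"
proof (induction w)
  case (Cons z w) then show ?case by (cases z) auto
qed simp

lemma fp_eq_tau_word:
  "fp_eq integer_group (sym_group m) w w' \<Longrightarrow>
    fp_eq integer_group (sym_group m) (tau_word w) (tau_word w')"
proof (induction rule: fp_eq.induct)
  case (refl w) then show ?case by (simp add: fp_eq.refl tau_word_in_words)
next
  case (sym w w') then show ?case by (simp add: fp_eq.sym)
next
  case (trans w w' w'') then show ?case by (blast intro: fp_eq.trans)
next
  case (mult_left u w x y)
  then show ?case
    using fp_eq.mult_left[of "tau_word u" integer_group "sym_group m" "tau_word w" "- x" "- y"]
    by (simp add: tau_word_in_words)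
next
  case (mult_right u w x y)
  then show ?case
    using fp_eq.mult_right[of "tau_word u" integer_group "sym_group m" "tau_word w" x y]
    by (simp add: tau_word_in_words)
next
  case (one_left u w)
  then show ?case
    using fp_eq.one_left[of "tau_word u" integer_group "sym_group m" "tau_word w"]
    by (simp add: tau_word_in_words)
next
  case (one_right u w)
  then show ?case
    using fp_eq.one_right[of "tau_word u" integer_group "sym_group m" "tau_word w"]
    by (simp add: tau_word_in_words)
qed

lemma tau_word_image_class:
  "tau_word ` fp_class integer_group (sym_group m) w = fp_class integer_group (sym_group m) (tau_word w)"
proof -
  have "v \<in> tau_word ` fp_class integer_group (sym_group m) w"
    if "fp_eq integer_group (sym_group m) (tau_word w) v" for v
    using fp_eq_tau_word[OF that] by (intro image_eqI[of _ _ "tau_word v"]) (auto simp: fp_class_def)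
  then show ?thesis by (auto simp: fp_class_def intro: fp_eq_tau_word)
qed

lemma tau_word_image_invol [simp]: "tau_word ` tau_word ` X = X"
  by (simp add: image_image)

lemma tau_aut_invol [simp]: "tau_aut (tau_aut C) = C"
  by (simp add: tau_aut_def image_image)

lemma y_free_carrier: "carrier (y_free m) = fp_class integer_group (sym_group m) ` fp_words integer_group (sym_group m)"
  by (simp add: free_product_def)

lemma tau_free_hom: "(`) tau_word \<in> hom (y_free m) (y_free m)"
  unfolding hom_def y_free_carrier
  by (auto simp: tau_word_image_class free_product_mult tau_word_in_words)

lemma tau_free_group_hom: "group_hom (y_free m) (y_free m) ((`) tau_word)"
  by (simp add: group_hom_def group_hom_axioms_def y_free_group tau_free_hom)

lemma free_a_carrier: "free_a m \<in> carrier (y_free m)"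
  by (simp add: free_a_def y_free_carrier)

lemma free_s_carrier: "1 \<le> i \<Longrightarrow> i < m \<Longrightarrow> free_s m i \<in> carrier (y_free m)"
  by (auto simp: free_s_def y_free_carrier sym_group_carrier intro!: imageI permutes_swap_id)

lemma tau_free_a: "tau_word ` free_a m = inv\<^bsub>y_free m\<^esub> free_a m"
proof -
  interpret F: group "y_free m" by (rule y_free_group)
  have "fp_eq integer_group (sym_group m) [Inl (- 1), Inl 1] []"
    using fp_eq.mult_left[of "[]" integer_group "sym_group m" "[]" "- 1" 1]
      fp_eq.one_left[of "[]" integer_group "sym_group m" "[]"] by (simp add: fp_eq.trans)
  then have "tau_word ` free_a m \<otimes>\<^bsub>y_free m\<^esub> free_a m = \<one>\<^bsub>y_free m\<^esub>"
    by (simp add: free_a_def tau_word_image_class free_product_mult fp_class_eqI) (simp add: free_product_def)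
  moreover have "tau_word ` free_a m \<in> carrier (y_free m)"
    by (rule hom_in_carrier[OF tau_free_hom free_a_carrier])
  ultimately show ?thesis using F.inv_equality[OF _ free_a_carrier] by simp
qed

lemma tau_free_s: "tau_word ` free_s m i = free_s m i"
  by (simp add: free_s_def tau_word_image_class)

lemma y_relators_carrier:
  assumes "m \<ge> 2"
  shows "y_relators m \<subseteq> carrier (y_free m)"
proof -
  interpret F: group "y_free m" by (rule y_free_group)
  have "free_s m 1 \<in> carrier (y_free m)" using assms by (intro free_s_carrier) auto
  moreover have "free_s m i \<in> carrier (y_free m)" if "2 \<le> i" "i \<le> m - 1" for i
    using that by (intro free_s_carrier) auto
  ultimately show ?thesis
    by (auto simp: y_relators_def commutator_def conjg_def free_a_carrier)
qed

lemma y_kernel_normal: "m \<ge> 2 \<Longrightarrow> y_kernel m \<lhd> y_free m"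
  unfolding y_kernel_def by (intro normal_closure_normal y_free_group y_relators_carrier)

lemma y_group_group: "m \<ge> 2 \<Longrightarrow> group (y_group m)"
  unfolding y_group_def by (intro normal.factorgroup_is_group y_kernel_normal)

lemma tau_free_kernel:
  assumes "m \<ge> 2"
  shows "(`) tau_word ` y_kernel m = y_kernel m"
proof -
  interpret F: group "y_free m" by (rule y_free_group)
  interpret N: normal "y_kernel m" "y_free m" by (rule y_kernel_normal[OF assms])
  interpret T: group_hom "y_free m" "y_free m" "(`) tau_word" by (rule tau_free_group_hom)
  let ?N = "{X \<in> carrier (y_free m). tau_word ` X \<in> y_kernel m}"
  have "subgroup ?N (y_free m)"
    by (rule F.subgroupI) (auto intro: N.m_closed N.one_closed)
  moreover have "x \<otimes>\<^bsub>y_free m\<^esub> h \<otimes>\<^bsub>y_free m\<^esub> inv\<^bsub>y_free m\<^esub> x \<in> ?N" if "x \<in> carrier (y_free m)" "h \<in> ?N" for x h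
    using that N.inv_op_closed2[of "tau_word ` x" "tau_word ` h"] by simp
  ultimately have "?N \<lhd> y_free m" unfolding F.normal_inv_iff by blast
  moreover have "y_relators m \<subseteq> ?N"
  proof
    fix r assume r: "r \<in> y_relators m"
    then have rc: "r \<in> carrier (y_free m)" using y_relators_carrier[OF assms] by auto
    have sub: "y_relators m \<subseteq> y_kernel m" unfolding y_kernel_def by (rule normal_closure_superset)
    have s1: "free_s m (Suc 0) \<in> carrier (y_free m)" using assms by (intro free_s_carrier) auto
    note a = free_a_carrier[of m]
    from r consider (c) k :: int where "r = commutator (y_free m) (free_s m 1) (conjg (y_free m) (free_s m 1) (free_a m [^]\<^bsub>y_free m\<^esub> k))"
      | (i) i where "r = conjg (y_free m) (free_a m) (free_s m i) \<otimes>\<^bsub>y_free m\<^esub> free_a m" "2 \<le> i" "i \<le> m - 1"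
      unfolding y_relators_def by blast
    then have "tau_word ` r \<in> y_kernel m"
    proof cases
      case c
      have "tau_word ` (free_a m [^]\<^bsub>y_free m\<^esub> k) = free_a m [^]\<^bsub>y_free m\<^esub> (- k)"
        using T.hom_int_pow[OF a, of k] by (simp add: tau_free_a F.int_pow_inv F.int_pow_neg a)
      then have "tau_word ` r = commutator (y_free m) (free_s m 1) (conjg (y_free m) (free_s m 1) (free_a m [^]\<^bsub>y_free m\<^esub> (- k)))"
        unfolding c by (simp add: commutator_def conjg_def s1 a tau_free_s)
      then have "tau_word ` r \<in> y_relators m" unfolding y_relators_def by blast
      then show ?thesis using sub by blast
    next
      case i
      have s: "free_s m i \<in> carrier (y_free m)" using i by (intro free_s_carrier) auto
      let ?a = "free_a m"
      have c: "x \<otimes>\<^bsub>y_free m\<^esub> (inv\<^bsub>y_free m\<^esub> x \<otimes>\<^bsub>y_free m\<^esub> y) = y" "inv\<^bsub>y_free m\<^esub> x \<otimes>\<^bsub>y_free m\<^esub> (x \<otimes>\<^bsub>y_free m\<^esub> y) = y"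
        if "x \<in> carrier (y_free m)" "y \<in> carrier (y_free m)" for x y
        using that by (simp_all flip: F.m_assoc)
      have "tau_word ` r = conjg (y_free m) (inv\<^bsub>y_free m\<^esub> ?a) (free_s m i) \<otimes>\<^bsub>y_free m\<^esub> inv\<^bsub>y_free m\<^esub> ?a"
        unfolding i by (simp add: conjg_def s a tau_free_s tau_free_a)
      also have "\<dots> = ?a \<otimes>\<^bsub>y_free m\<^esub> inv\<^bsub>y_free m\<^esub> r \<otimes>\<^bsub>y_free m\<^esub> inv\<^bsub>y_free m\<^esub> ?a"
        unfolding i by (simp add: conjg_def s a F.inv_mult_group F.m_assoc c)
      finally show ?thesis using N.inv_op_closed2[OF a] r sub by auto
    qed
    then show "r \<in> ?N" using rc by simp
  qed
  ultimately have "y_kernel m \<subseteq> ?N" unfolding y_kernel_def by (rule normal_closure_least)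
  then have *: "tau_word ` X \<in> y_kernel m" if "X \<in> y_kernel m" for X using that by auto
  show ?thesis
  proof
    show "(`) tau_word ` y_kernel m \<subseteq> y_kernel m" using * by blast
    show "y_kernel m \<subseteq> (`) tau_word ` y_kernel m"
    proof
      fix X assume "X \<in> y_kernel m"
      then show "X \<in> (`) tau_word ` y_kernel m"
        using * by (intro image_eqI[of _ _ "tau_word ` X"]) simp_all
    qed
  qed
qed

lemma tau_aut_coset:
  assumes "m \<ge> 2" "X \<in> carrier (y_free m)"
  shows "tau_aut (y_kernel m #>\<^bsub>y_free m\<^esub> X) = y_kernel m #>\<^bsub>y_free m\<^esub> (tau_word ` X)"
proof -
  interpret T: group_hom "y_free m" "y_free m" "(`) tau_word" by (rule tau_free_group_hom)
  have sub: "y_kernel m \<subseteq> carrier (y_free m)"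
    using y_kernel_normal[OF assms(1)] by (intro subgroup.subset normal_imp_subgroup)
  have "tau_aut (y_kernel m #>\<^bsub>y_free m\<^esub> X) = (\<lambda>h. tau_word ` h \<otimes>\<^bsub>y_free m\<^esub> tau_word ` X) ` y_kernel m"
  proof -
    have "tau_word ` (h \<otimes>\<^bsub>y_free m\<^esub> X) = tau_word ` h \<otimes>\<^bsub>y_free m\<^esub> tau_word ` X" if "h \<in> y_kernel m" for h
      using that sub assms(2) by (intro T.hom_mult) auto
    moreover have "y_kernel m #>\<^bsub>y_free m\<^esub> X = (\<lambda>h. h \<otimes>\<^bsub>y_free m\<^esub> X) ` y_kernel m"
      unfolding r_coset_def by blast
    ultimately show ?thesis by (simp add: tau_aut_def image_image)
  qed
  also have "\<dots> = (\<lambda>h. h \<otimes>\<^bsub>y_free m\<^esub> tau_word ` X) ` ((`) tau_word ` y_kernel m)"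
    by (simp add: image_image)
  also have "\<dots> = y_kernel m #>\<^bsub>y_free m\<^esub> (tau_word ` X)"
    unfolding tau_free_kernel[OF assms(1)] r_coset_def by auto
  finally show ?thesis .
qed

lemma tau_aut_hom:
  assumes "m \<ge> 2"
  shows "tau_aut \<in> hom (y_group m) (y_group m)"
proof -
  interpret N: normal "y_kernel m" "y_free m" by (rule y_kernel_normal[OF assms])
  interpret T: group_hom "y_free m" "y_free m" "(`) tau_word" by (rule tau_free_group_hom)
  show ?thesis
    unfolding hom_def y_group_def carrier_FactGroup mult_FactGroup
    by (auto simp: tau_aut_coset[OF assms] N.rcos_sum)
qed

lemma tau_aut_y_s:
  assumes "m \<ge> 2" "1 \<le> i" "i < m"
  shows "tau_aut (y_s m i) = y_s m i"
  using assms by (simp add: y_s_def tau_aut_coset free_s_carrier tau_free_s)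

lemma tau_aut_y_a:
  assumes "m \<ge> 2"
  shows "tau_aut (y_a m) = inv\<^bsub>y_group m\<^esub> y_a m"
proof -
  interpret N: normal "y_kernel m" "y_free m" by (rule y_kernel_normal[OF assms])
  have "y_a m \<in> carrier (y_group m)"
    by (simp add: y_a_def y_group_def carrier_FactGroup free_a_carrier)
  then have "inv\<^bsub>y_group m\<^esub> y_a m = set_inv\<^bsub>y_free m\<^esub> (y_a m)"
    by (simp add: y_group_def N.inv_FactGroup)
  also have "\<dots> = y_kernel m #>\<^bsub>y_free m\<^esub> inv\<^bsub>y_free m\<^esub> free_a m"
    by (simp add: y_a_def N.rcos_inv free_a_carrier)
  finally show ?thesis
    by (simp add: y_a_def tau_aut_coset assms free_a_carrier tau_free_a)
qed

lemma yt_group_group: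
  assumes "m \<ge> 2"
  shows "group (yt_group m)"
proof -
  interpret Y: group "y_group m" by (rule y_group_group[OF assms])
  interpret T: group_hom "y_group m" "y_group m" tau_aut
    by (simp add: group_hom_def group_hom_axioms_def Y.is_group tau_aut_hom[OF assms])
  let ?Y = "y_group m"
  have carr: "carrier (yt_group m) = carrier ?Y \<times> {0, 1}"
    by (auto simp: yt_group_def semidirect_product_def carrier_integer_mod_group)
  have one: "\<one>\<^bsub>yt_group m\<^esub> = (\<one>\<^bsub>?Y\<^esub>, 0)" by (simp add: yt_group_def semidirect_product_def)
  have mult: "(g, k) \<otimes>\<^bsub>yt_group m\<^esub> (h, l) = (g \<otimes>\<^bsub>?Y\<^esub> (if k = 1 then tau_aut h else h), (k + l) mod 2)"
    for g k h l by (simp add: yt_group_def semidirect_product_def)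
  show ?thesis
  proof (rule groupI, goal_cases)
    case (5 x)
    then obtain g k where x: "x = (g, k)" "g \<in> carrier ?Y" "k = 0 \<or> k = 1" unfolding carr by auto
    have t: "tau_aut (inv\<^bsub>?Y\<^esub> g) \<otimes>\<^bsub>?Y\<^esub> tau_aut g = \<one>\<^bsub>?Y\<^esub>"
      using x T.hom_mult[of "inv\<^bsub>?Y\<^esub> g" g] by simp
    have c: "tau_aut (inv\<^bsub>?Y\<^esub> g) \<in> carrier ?Y" using x by (intro T.hom_closed) simp
    show ?case
    proof (cases "k = 0")
      case True
      then show ?thesis using x by (intro bexI[of _ "(inv\<^bsub>?Y\<^esub> g, 0)"]) (simp_all add: carr one mult)
    next
      case False
      then have "k = 1" using x by simp
      then show ?thesis using x t c
        by (intro bexI[of _ "(tau_aut (inv\<^bsub>?Y\<^esub> g), 1)"]) (simp_all add: carr one mult del: T.hom_inv)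
    qed
  next
    case (3 x y z)
    then obtain g k h l f j where "x = (g, k)" "y = (h, l)" "z = (f, j)"
      "g \<in> carrier ?Y" "h \<in> carrier ?Y" "f \<in> carrier ?Y"
      "k = 0 \<or> k = 1" "l = 0 \<or> l = 1" "j = 0 \<or> j = 1"
      unfolding carr by blast
    then show ?case by (elim disjE) (simp_all add: mult Y.m_assoc)
  next
    case (1 x y)
    then obtain g k h l where "x = (g, k)" "y = (h, l)" "g \<in> carrier ?Y" "h \<in> carrier ?Y"
      "k = 0 \<or> k = 1" "l = 0 \<or> l = 1"
      unfolding carr by blast
    then show ?case by (elim disjE) (simp_all add: mult carr)
  qed (auto simp: carr one mult)
qed

section \<open>Clifford algebras of free modules\<close>

text \<open>The free \<open>'r\<close>-module with basis \<open>B\<close>, as finitely supported functions.\<close>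

definition free_module :: "'b set \<Rightarrow> ('b \<Rightarrow>\<^sub>0 'r::zero) set"
  where "free_module B = {x. Poly_Mapping.keys x \<subseteq> B}"

datatype 'b tword = TWord (letters: "'b list")

instantiation tword :: (type) monoid_add
begin
definition "0 = TWord []"
definition "x + y = TWord (letters x @ letters y)"
instance by standard (auto simp: zero_tword_def plus_tword_def)
end

text \<open>
  If $V$ is free with basis $B$, then $V^{\otimes n}$ is free on $B^n$ and the product of $T(V)$
  concatenates tuples. So $T(V)$ consists of the finitely supported functions on words over $B$,
  with the convolution product supplied by the type class instance of \<open>\<Rightarrow>\<^sub>0\<close>.
\<close>

definition tensor_algebra :: "'b set \<Rightarrow> ('b tword \<Rightarrow>\<^sub>0 'r::comm_ring_1) ring"
  where "tensor_algebra B =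
    \<lparr>carrier = {p. \<forall>w\<in>Poly_Mapping.keys p. set (letters w) \<subseteq> B},
     monoid.mult = (*), one = 1, zero = 0, add = (+)\<rparr>"

definition tscal :: "'r \<Rightarrow> ('b tword \<Rightarrow>\<^sub>0 'r::comm_ring_1)"
  where "tscal r = Poly_Mapping.single 0 r"

definition tvec :: "('b \<Rightarrow>\<^sub>0 'r) \<Rightarrow> ('b tword \<Rightarrow>\<^sub>0 'r::comm_ring_1)"
  where "tvec x = (\<Sum>b\<in>Poly_Mapping.keys x. Poly_Mapping.single (TWord [b]) (Poly_Mapping.lookup x b))"

definition clifford_ideal :: "'b set \<Rightarrow> (('b \<Rightarrow>\<^sub>0 'r) \<Rightarrow> 'r) \<Rightarrow> ('b tword \<Rightarrow>\<^sub>0 'r::comm_ring_1) set"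
  where "clifford_ideal B q =
    genideal (tensor_algebra B) {tvec w * tvec w - tscal (q w) | w. w \<in> free_module B}"

definition clifford_algebra :: "'b set \<Rightarrow> (('b \<Rightarrow>\<^sub>0 'r) \<Rightarrow> 'r) \<Rightarrow> ('b tword \<Rightarrow>\<^sub>0 'r::comm_ring_1) set ring"
  where "clifford_algebra B q = tensor_algebra B Quot clifford_ideal B q"

text \<open>The canonical maps $R \to Cl$ and $V \to Cl$.\<close>

definition cl_scal :: "'b set \<Rightarrow> (('b \<Rightarrow>\<^sub>0 'r) \<Rightarrow> 'r) \<Rightarrow> 'r \<Rightarrow> ('b tword \<Rightarrow>\<^sub>0 'r::comm_ring_1) set"
  where "cl_scal B q r = clifford_ideal B q +>\<^bsub>tensor_algebra B\<^esub> tscal r"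

definition cl_vec :: "'b set \<Rightarrow> (('b \<Rightarrow>\<^sub>0 'r) \<Rightarrow> 'r) \<Rightarrow> ('b \<Rightarrow>\<^sub>0 'r) \<Rightarrow> ('b tword \<Rightarrow>\<^sub>0 'r::comm_ring_1) set"
  where "cl_vec B q w = clifford_ideal B q +>\<^bsub>tensor_algebra B\<^esub> tvec w"

text \<open>
  Reversing words is an anti-automorphism of $T(V)$ preserving the ideal, so its image on a coset is
  a coset; this gives the anti-automorphism of $Cl$; see \<open>cl_rev_mult\<close>, \<open>cl_rev_cl_vec\<close>.
\<close>

definition trev :: "('b tword \<Rightarrow>\<^sub>0 'r) \<Rightarrow> ('b tword \<Rightarrow>\<^sub>0 'r::comm_ring_1)"
  where "trev p = Poly_Mapping.map_key (\<lambda>w. TWord (rev (letters w))) p"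

definition cl_rev :: "('b tword \<Rightarrow>\<^sub>0 'r) set \<Rightarrow> ('b tword \<Rightarrow>\<^sub>0 'r::comm_ring_1) set"
  where "cl_rev X = trev ` X"

definition clifford_group_set :: "'b set \<Rightarrow> (('b \<Rightarrow>\<^sub>0 'r) \<Rightarrow> 'r) \<Rightarrow> ('b tword \<Rightarrow>\<^sub>0 'r::comm_ring_1) set set"
  where "clifford_group_set B q = {c \<in> Units (clifford_algebra B q).
    \<forall>v\<in>cl_vec B q ` free_module B.
      inv\<^bsub>clifford_algebra B q\<^esub> c \<otimes>\<^bsub>clifford_algebra B q\<^esub> v \<otimes>\<^bsub>clifford_algebra B q\<^esub> c
        \<in> cl_vec B q ` free_module B}"

definition pin_set :: "'b set \<Rightarrow> (('b \<Rightarrow>\<^sub>0 'r) \<Rightarrow> 'r) \<Rightarrow> ('b tword \<Rightarrow>\<^sub>0 'r::comm_ring_1) set set"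
  where "pin_set B q = {c \<in> clifford_group_set B q.
    c \<otimes>\<^bsub>clifford_algebra B q\<^esub> cl_rev c = \<one>\<^bsub>clifford_algebra B q\<^esub>}"

definition pin_group :: "'b set \<Rightarrow> (('b \<Rightarrow>\<^sub>0 'r) \<Rightarrow> 'r) \<Rightarrow> ('b tword \<Rightarrow>\<^sub>0 'r::comm_ring_1) set monoid"
  where "pin_group B q = (units_of (clifford_algebra B q)) \<lparr>carrier := pin_set B q\<rparr>"

lemma letters_simps [simp]: "letters 0 = []" "letters (x + y) = letters x @ letters y"
  by (simp_all add: zero_tword_def plus_tword_def)

lemma tensor_algebra_simps [simp]:
  "p \<in> carrier (tensor_algebra B) \<longleftrightarrow> (\<forall>w\<in>Poly_Mapping.keys p. set (letters w) \<subseteq> B)"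
  "p \<otimes>\<^bsub>tensor_algebra B\<^esub> p' = p * p'" "\<one>\<^bsub>tensor_algebra B\<^esub> = 1"
  "p \<oplus>\<^bsub>tensor_algebra B\<^esub> p' = p + p'" "\<zero>\<^bsub>tensor_algebra B\<^esub> = 0"
  by (simp_all add: tensor_algebra_def)

lemma tensor_algebra_ring:
  fixes B :: "'b set"
  shows "ring (tensor_algebra B :: ('b tword \<Rightarrow>\<^sub>0 'r::comm_ring_1) ring)"
proof -
  let ?T = "tensor_algebra B :: ('b tword \<Rightarrow>\<^sub>0 'r) ring"
  show ?thesis
  proof (rule ringI)
    show "abelian_group (?T)"
    proof (rule abelian_groupI)
      fix x :: "'b tword \<Rightarrow>\<^sub>0 'r" assume "x \<in> carrier (?T)"
      then show "\<exists>y\<in>carrier (?T). y \<oplus>\<^bsub>?T\<^esub> x = \<zero>\<^bsub>?T\<^esub>"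
        by (intro bexI[of _ "- x"]) auto
    next
      fix x y :: "'b tword \<Rightarrow>\<^sub>0 'r"
      assume "x \<in> carrier (?T)" "y \<in> carrier (?T)"
      then show "x \<oplus>\<^bsub>?T\<^esub> y \<in> carrier (?T)"
        using keys_add[of x y] by fastforce
    qed (simp_all add: add_ac)
    show "monoid (?T)"
    proof (rule monoidI)
      fix x y :: "'b tword \<Rightarrow>\<^sub>0 'r"
      assume "x \<in> carrier (?T)" "y \<in> carrier (?T)"
      then show "x \<otimes>\<^bsub>?T\<^esub> y \<in> carrier (?T)"
        using keys_mult[of x y] by fastforce
    qed (simp_all add: mult.assoc)
  qed (simp_all add: distrib_left distrib_right)
qed

lemma tscal_carrier: "tscal r \<in> carrier (tensor_algebra B)"
  by (simp add: tscal_def)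

lemma tvec_sum:
  assumes "finite S" "Poly_Mapping.keys x \<subseteq> S"
  shows "tvec x = (\<Sum>b\<in>S. Poly_Mapping.single (TWord [b]) (Poly_Mapping.lookup x b))"
  unfolding tvec_def using assms by (intro sum.mono_neutral_left) (auto simp: in_keys_iff)

lemma tvec_add: "tvec (x + y) = tvec x + tvec y"
proof -
  let ?S = "Poly_Mapping.keys x \<union> Poly_Mapping.keys y"
  have "Poly_Mapping.keys (x + y) \<subseteq> ?S" by (rule keys_add)
  then show ?thesis
    by (simp add: tvec_sum[of ?S] lookup_add single_add sum.distrib)
qed

lemma tvec_single [simp]: "tvec (Poly_Mapping.single b r) = Poly_Mapping.single (TWord [b]) r"
  by (simp add: tvec_def)

lemma tvec_scale: "tvec (Poly_Mapping.map ((*) r) x) = tscal r * tvec x"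
proof -
  have l: "Poly_Mapping.lookup (Poly_Mapping.map ((*) r) x) b = r * Poly_Mapping.lookup x b" for b
    by (simp add: Poly_Mapping.map.rep_eq when_def)
  then have "Poly_Mapping.keys (Poly_Mapping.map ((*) r) x) \<subseteq> Poly_Mapping.keys x"
    by (auto simp: in_keys_iff)
  then show ?thesis
    by (simp add: tvec_sum[of "Poly_Mapping.keys x"] tscal_def sum_distrib_left mult_single l)
qed

lemma tensor_monomials: "p = (\<Sum>w\<in>Poly_Mapping.keys p. Poly_Mapping.single w (Poly_Mapping.lookup p w))"
  by (rule poly_mapping_eqI) (auto simp: lookup_sum lookup_single when_def in_keys_iff)

lemma tscal_central: "tscal r * p = p * tscal r"
proof -
  have "tscal r * (\<Sum>w\<in>Poly_Mapping.keys p. Poly_Mapping.single w (Poly_Mapping.lookup p w)) =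
    (\<Sum>w\<in>Poly_Mapping.keys p. Poly_Mapping.single w (Poly_Mapping.lookup p w)) * tscal r"
    by (simp add: tscal_def sum_distrib_left sum_distrib_right mult_single mult.commute)
  then show ?thesis by (simp flip: tensor_monomials)
qed

lemma tvec_carrier: "x \<in> free_module B \<Longrightarrow> tvec x \<in> carrier (tensor_algebra B)"
  unfolding tvec_def free_module_def tensor_algebra_simps
  using keys_sum[of "\<lambda>b. Poly_Mapping.single (TWord [b]) (Poly_Mapping.lookup x b)" "Poly_Mapping.keys x"]
  by (fastforce split: if_splits)

lemma tensor_mem_mult:
  "p \<in> carrier (tensor_algebra B) \<Longrightarrow> p' \<in> carrier (tensor_algebra B) \<Longrightarrow> p * p' \<in> carrier (tensor_algebra B)"
  using monoid.m_closed[OF ring.axioms(2)[OF tensor_algebra_ring]] by (metis tensor_algebra_simps(2))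

lemma tensor_mem_diff:
  fixes p p' :: "'b tword \<Rightarrow>\<^sub>0 'r::comm_ring_1"
  shows "p \<in> carrier (tensor_algebra B) \<Longrightarrow> p' \<in> carrier (tensor_algebra B) \<Longrightarrow> p - p' \<in> carrier (tensor_algebra B)"
  using keys_diff[of p p'] by fastforce

lemma clifford_ideal_ideal: "ideal (clifford_ideal B q) (tensor_algebra B)"
  unfolding clifford_ideal_def
  by (rule ring.genideal_ideal[OF tensor_algebra_ring])
    (auto simp del: tensor_algebra_simps intro!: tensor_mem_diff tensor_mem_mult tvec_carrier tscal_carrier)

lemma clifford_algebra_ring: "ring (clifford_algebra B q)"
  unfolding clifford_algebra_def by (rule ideal.quotient_is_ring[OF clifford_ideal_ideal])

lemma lookup_trev:
  fixes p :: "'b tword \<Rightarrow>\<^sub>0 'r::comm_ring_1"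
  shows "Poly_Mapping.lookup (trev p) w = Poly_Mapping.lookup p (TWord (rev (letters w)))"
proof -
  have "inj (\<lambda>w :: 'b tword. TWord (rev (letters w)))" by (rule injI) (metis rev_rev_ident tword.expand tword.inject)
  then show ?thesis unfolding trev_def by (simp add: Poly_Mapping.map_key.rep_eq[OF \<open>inj _\<close>])
qed

lemma trev_add: "trev (p + p') = trev p + trev p'"
  by (rule poly_mapping_eqI) (simp add: lookup_trev lookup_add)

lemma trev_zero [simp]: "trev 0 = 0"
  by (rule poly_mapping_eqI) (simp add: lookup_trev)

lemma trev_uminus: "trev (- p) = - trev p"
  by (rule poly_mapping_eqI) (simp add: lookup_trev)

lemma trev_trev [simp]: "trev (trev p) = p"
  by (rule poly_mapping_eqI) (simp add: lookup_trev)

lemma trev_single [simp]: "trev (Poly_Mapping.single w r) = Poly_Mapping.single (TWord (rev (letters w))) r"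
  by (rule poly_mapping_eqI) (auto simp: lookup_trev lookup_single when_def)

lemma keys_trev: "w \<in> Poly_Mapping.keys (trev p) \<longleftrightarrow> TWord (rev (letters w)) \<in> Poly_Mapping.keys p"
  by (simp add: in_keys_iff lookup_trev)

lemma trev_carrier:
  fixes p :: "'b tword \<Rightarrow>\<^sub>0 'r::comm_ring_1"
  shows "trev p \<in> carrier (tensor_algebra B) \<longleftrightarrow> p \<in> carrier (tensor_algebra B)"
proof -
  have "trev p \<in> carrier (tensor_algebra B)" if "p \<in> carrier (tensor_algebra B)" for p :: "'b tword \<Rightarrow>\<^sub>0 'r"
    using that by (fastforce simp: keys_trev)
  then show ?thesis using trev_trev by metis
qed

lemma trev_sum: "trev (sum f A) = (\<Sum>a\<in>A. trev (f a))"
  by (induction A rule: infinite_finite_induct) (simp_all add: trev_add)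

lemma trev_mult: "trev (p * p') = trev p' * trev p"
proof -
  have "trev ((\<Sum>v\<in>Poly_Mapping.keys p. Poly_Mapping.single v (Poly_Mapping.lookup p v)) *
      (\<Sum>w\<in>Poly_Mapping.keys p'. Poly_Mapping.single w (Poly_Mapping.lookup p' w))) =
    trev (\<Sum>w\<in>Poly_Mapping.keys p'. Poly_Mapping.single w (Poly_Mapping.lookup p' w)) *
    trev (\<Sum>v\<in>Poly_Mapping.keys p. Poly_Mapping.single v (Poly_Mapping.lookup p v))"
    unfolding trev_sum sum_product
    by (subst sum.swap) (simp add: trev_sum mult_single plus_tword_def mult.commute)
  then show ?thesis by (simp flip: tensor_monomials)
qed

lemma trev_tvec [simp]: "trev (tvec x) = tvec x"
  by (simp add: tvec_def trev_sum)

lemma trev_tscal [simp]: "trev (tscal r) = tscal r"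
  by (simp add: tscal_def zero_tword_def)

lemma trev_clifford_ideal:
  fixes q :: "('b \<Rightarrow>\<^sub>0 'r::comm_ring_1) \<Rightarrow> 'r"
  shows "trev ` clifford_ideal B q = clifford_ideal B q"
proof -
  let ?T = "tensor_algebra B :: ('b tword \<Rightarrow>\<^sub>0 'r) ring" let ?I = "clifford_ideal B q"
  let ?S = "{tvec w * tvec w - tscal (q w) | w. w \<in> free_module B}"
  interpret T: ring ?T by (rule tensor_algebra_ring)
  interpret I: ideal ?I ?T by (rule clifford_ideal_ideal)
  let ?J = "{p \<in> carrier ?T. trev p \<in> ?I}"
  have tc: "?S \<subseteq> carrier ?T"
    by (auto simp del: tensor_algebra_simps intro!: tensor_mem_diff tensor_mem_mult tvec_carrier tscal_carrier)
  have "ideal ?J ?T"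
  proof (rule idealI)
    show "ring ?T" by (rule tensor_algebra_ring)
    show "subgroup ?J (add_monoid ?T)"
    proof (rule T.add.subgroupI)
      show "?J \<noteq> {}"
        using I.zero_closed by (auto intro!: exI[of _ 0])
    next
      fix p assume p: "p \<in> ?J"
      have "\<ominus>\<^bsub>?T\<^esub> p = - p" by (rule T.minus_equality) (use p in auto)
      moreover have "\<ominus>\<^bsub>?T\<^esub> trev p = - trev p"
        by (rule T.minus_equality) (use p trev_carrier[of p B] in auto)
      moreover have "\<ominus>\<^bsub>?T\<^esub> trev p \<in> ?I" using p by (intro I.a_inv_closed) auto
      moreover have "\<ominus>\<^bsub>?T\<^esub> p \<in> carrier ?T" using p by (intro T.a_inv_closed) blast
      ultimately show "\<ominus>\<^bsub>?T\<^esub> p \<in> ?J" by (simp add: trev_uminus)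
    next
      fix p p' assume "p \<in> ?J" "p' \<in> ?J"
      then show "p \<oplus>\<^bsub>?T\<^esub> p' \<in> ?J"
        using T.add.m_closed[of p p'] I.a_closed[of "trev p" "trev p'"] by (simp add: trev_add)
    qed blast
  next
    fix p x assume "p \<in> ?J" "x \<in> carrier ?T"
    then show "x \<otimes>\<^bsub>?T\<^esub> p \<in> ?J"
      using T.m_closed[of x p] I.I_r_closed[of "trev p" "trev x"] trev_carrier[of x B]
      by (simp add: trev_mult del: tensor_algebra_simps(1))
  next
    fix p x assume "p \<in> ?J" "x \<in> carrier ?T"
    then show "p \<otimes>\<^bsub>?T\<^esub> x \<in> ?J"
      using T.m_closed[of p x] I.I_l_closed[of "trev p" "trev x"] trev_carrier[of x B]
      by (simp add: trev_mult del: tensor_algebra_simps(1))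
  qed
  moreover have "?S \<subseteq> ?J"
  proof
    fix r assume r: "r \<in> ?S"
    then have "trev r = r" by (auto simp: diff_conv_add_uminus trev_add trev_uminus trev_mult simp del: add_uminus_conv_diff)
    moreover have "r \<in> carrier ?T" using r tc by blast
    moreover have "r \<in> ?I" using r T.genideal_self[OF tc] unfolding clifford_ideal_def by blast
    ultimately show "r \<in> ?J" by simp
  qed
  ultimately have "?I \<subseteq> ?J" using T.genideal_minimal[of ?J ?S] unfolding clifford_ideal_def by blast
  then have *: "trev p \<in> ?I" if "p \<in> ?I" for p using that by blast
  show ?thesis
  proof
    show "trev ` ?I \<subseteq> ?I" using * by blast
    show "?I \<subseteq> trev ` ?I"
    proof
      fix p assume "p \<in> ?I"
      then show "p \<in> trev ` ?I" using * by (intro image_eqI[of _ _ "trev p"]) simp_all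
    qed
  qed
qed

lemma cl_rev_coset:
  "cl_rev (clifford_ideal B q +>\<^bsub>tensor_algebra B\<^esub> p) = clifford_ideal B q +>\<^bsub>tensor_algebra B\<^esub> trev p"
proof -
  have *: "clifford_ideal B q +>\<^bsub>tensor_algebra B\<^esub> p = (\<lambda>h. h + p) ` clifford_ideal B q" for p
    by (auto simp: a_r_coset_def r_coset_def)
  have "cl_rev (clifford_ideal B q +>\<^bsub>tensor_algebra B\<^esub> p) = (\<lambda>h. h + trev p) ` (trev ` clifford_ideal B q)"
    unfolding cl_rev_def * by (simp add: image_image trev_add)
  then show ?thesis by (simp add: trev_clifford_ideal *)
qed

lemma cl_rev_cl_vec: "cl_rev (cl_vec B q x) = cl_vec B q x"
  by (simp add: cl_vec_def cl_rev_coset)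

lemma cl_rev_cl_scal: "cl_rev (cl_scal B q r) = cl_scal B q r"
  by (simp add: cl_scal_def cl_rev_coset)

lemma cl_rev_mult:
  assumes "X \<in> carrier (clifford_algebra B q)" "Y \<in> carrier (clifford_algebra B q)"
  shows "cl_rev (X \<otimes>\<^bsub>clifford_algebra B q\<^esub> Y) = cl_rev Y \<otimes>\<^bsub>clifford_algebra B q\<^esub> cl_rev X"
proof -
  interpret I: ideal "clifford_ideal B q" "tensor_algebra B" by (rule clifford_ideal_ideal)
  obtain x y where "x \<in> carrier (tensor_algebra B)" "X = clifford_ideal B q +>\<^bsub>tensor_algebra B\<^esub> x"
    "y \<in> carrier (tensor_algebra B)" "Y = clifford_ideal B q +>\<^bsub>tensor_algebra B\<^esub> y"
    using assms unfolding clifford_algebra_def FactRing_simps by auto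
  then show ?thesis
    using trev_carrier[of x B] trev_carrier[of y B]
    by (simp add: clifford_algebra_def FactRing_def I.rcoset_mult_add cl_rev_coset trev_mult del: tensor_algebra_simps(1))
qed

lemma cl_vec_square:
  fixes q :: "('b \<Rightarrow>\<^sub>0 'r::comm_ring_1) \<Rightarrow> 'r"
  assumes "w \<in> free_module B"
  shows "cl_vec B q w \<otimes>\<^bsub>clifford_algebra B q\<^esub> cl_vec B q w = cl_scal B q (q w)"
proof -
  let ?T = "tensor_algebra B :: ('b tword \<Rightarrow>\<^sub>0 'r) ring"
  interpret T: ring ?T by (rule tensor_algebra_ring)
  interpret I: ideal "clifford_ideal B q" ?T by (rule clifford_ideal_ideal)
  let ?S = "{tvec w * tvec w - tscal (q w) | w. w \<in> free_module B}"
  have tc: "?S \<subseteq> carrier ?T"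
    by (auto simp del: tensor_algebra_simps intro!: tensor_mem_diff tensor_mem_mult tvec_carrier tscal_carrier)
  have "tvec w * tvec w - tscal (q w) \<in> clifford_ideal B q"
    using T.genideal_self[OF tc] assms unfolding clifford_ideal_def by blast
  then have "tvec w * tvec w \<in> clifford_ideal B q +>\<^bsub>?T\<^esub> tscal (q w)"
    by (force simp: a_r_coset_def r_coset_def)
  then have "clifford_ideal B q +>\<^bsub>?T\<^esub> (tvec w * tvec w) = clifford_ideal B q +>\<^bsub>?T\<^esub> tscal (q w)"
    using T.a_repr_independence[OF _ tscal_carrier I.a_subgroup] by simp
  then show ?thesis
    using tvec_carrier[OF assms]
    by (simp add: cl_vec_def cl_scal_def clifford_algebra_def FactRing_def I.rcoset_mult_add del: tensor_algebra_simps(1))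
qed

section \<open>The quadratic module $(V, q)$\<close>

text \<open>
  Laurent polynomials over $\mathbb F_2$ are the group algebra of the additive group of integers.
  The module $V$ is \<open>free_module {0..m}\<close>, index \<open>0\<close> standing for $u$ and \<open>i \<ge> 1\<close> for $v_i$.
\<close>

type_synonym laurent = "int \<Rightarrow>\<^sub>0 bit"

definition s_pow :: "int \<Rightarrow> laurent"
  where "s_pow k = Poly_Mapping.single k 1"

abbreviation vec_u :: "nat \<Rightarrow>\<^sub>0 laurent"
  where "vec_u \<equiv> Poly_Mapping.single 0 1"

abbreviation vec_v :: "nat \<Rightarrow> (nat \<Rightarrow>\<^sub>0 laurent)"
  where "vec_v i \<equiv> Poly_Mapping.single i 1"

definition V_form :: "nat \<Rightarrow> (nat \<Rightarrow>\<^sub>0 laurent) \<Rightarrow> (nat \<Rightarrow>\<^sub>0 laurent) \<Rightarrow> laurent"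
  where "V_form m x y =
    (\<Sum>i\<in>{0..m}. \<Sum>j\<in>{0..m} - {i}. Poly_Mapping.lookup x i * Poly_Mapping.lookup y j)"

text \<open>
  In coordinates, a quadratic form is determined by its values on a basis and its polarisation:
  $q(\sum_i x_i e_i) = \sum_i x_i^2 q(e_i) + \sum_{j<i} x_i x_j (e_i, e_j)$. Here $t^{-1} = s^{-2}$.
  See \<open>V_quad_add\<close>, \<open>V_quad_scale\<close>, \<open>V_quad_basis\<close>.
\<close>

definition V_quad :: "nat \<Rightarrow> (nat \<Rightarrow>\<^sub>0 laurent) \<Rightarrow> laurent"
  where "V_quad m x =
    (\<Sum>i\<in>{0..m}. (Poly_Mapping.lookup x i)\<^sup>2 * (if i = 0 then 1 else s_pow (-2)))
    + (\<Sum>i\<in>{0..m}. \<Sum>j\<in>{0..<i}. Poly_Mapping.lookup x i * Poly_Mapping.lookup x j)"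

lemma laurent_double [simp]: "(x :: laurent) + x = 0"
  by (rule poly_mapping_eqI) (simp only: lookup_add, simp)

lemma laurent_two [simp]: "(2 :: laurent) = 0"
  using laurent_double[of 1] by (simp only: one_add_one)

lemma s_pow_add: "s_pow (j + k) = s_pow j * s_pow k"
  by (simp add: s_pow_def mult_single)

lemma V_form_basis:
  assumes "i \<le> m" "j \<le> m"
  shows "V_form m (Poly_Mapping.single i 1) (Poly_Mapping.single j 1) = (if i = j then 0 else 1)"
proof -
  have "V_form m (Poly_Mapping.single i 1) (Poly_Mapping.single j 1)
    = (\<Sum>k\<in>{0..m}. if k = i then (\<Sum>l\<in>{0..m} - {i}. if l = j then 1 else 0) else 0)"
    unfolding V_form_def by (intro sum.cong) (auto simp: lookup_single when_def)
  then show ?thesis using assms by (auto simp: sum.delta)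
qed

lemma V_quad_add: "V_quad m (x + y) = V_quad m x + V_quad m y + V_form m x y"
proof -
  let ?x = "Poly_Mapping.lookup x" and ?y = "Poly_Mapping.lookup y"
  have sq: "(a + b)\<^sup>2 = a\<^sup>2 + b\<^sup>2" for a b :: laurent
    by (simp add: power2_sum)
  have "(\<Sum>i\<in>{0..m}. \<Sum>j\<in>{0..m} - {i}. ?x i * ?y j)
    = (\<Sum>i\<in>{0..m}. \<Sum>j\<in>{0..<i}. ?x i * ?y j) + (\<Sum>i\<in>{0..m}. \<Sum>j\<in>{i<..m}. ?x i * ?y j)"
    unfolding sum.distrib[symmetric]
  proof (rule sum.cong)
    fix i assume "i \<in> {0..m}"
    then have S: "{0..m} - {i} = {0..<i} \<union> {i<..m}" by auto
    show "(\<Sum>j\<in>{0..m} - {i}. ?x i * ?y j) = (\<Sum>j\<in>{0..<i}. ?x i * ?y j) + (\<Sum>j\<in>{i<..m}. ?x i * ?y j)"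
      unfolding S by (rule sum.union_disjoint) auto
  qed simp
  also have "(\<Sum>i\<in>{0..m}. \<Sum>j\<in>{i<..m}. ?x i * ?y j) = (\<Sum>i\<in>{0..m}. \<Sum>j\<in>{0..<i}. ?x j * ?y i)"
  proof -
    have "(\<Sum>i\<in>{0..m}. \<Sum>j\<in>{i<..m}. ?x i * ?y j) = (\<Sum>i\<in>{0..m}. \<Sum>j\<in>{0..m}. if i < j then ?x i * ?y j else 0)"
      by (intro sum.cong refl sum.mono_neutral_cong_left) auto
    also have "\<dots> = (\<Sum>j\<in>{0..m}. \<Sum>i\<in>{0..m}. if i < j then ?x i * ?y j else 0)"
      by (rule sum.swap)
    also have "\<dots> = (\<Sum>j\<in>{0..m}. \<Sum>i\<in>{0..<j}. ?x i * ?y j)"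
      by (intro sum.cong refl sum.mono_neutral_cong_right) auto
    finally show ?thesis .
  qed
  finally have "V_form m x y = (\<Sum>i\<in>{0..m}. \<Sum>j\<in>{0..<i}. ?x i * ?y j + ?x j * ?y i)"
    by (simp add: V_form_def sum.distrib)
  then show ?thesis
    by (simp add: V_quad_def lookup_add sq algebra_simps sum.distrib)
qed

lemma V_quad_scale: "V_quad m (Poly_Mapping.map ((*) r) x) = r\<^sup>2 * V_quad m x"
proof -
  have "Poly_Mapping.lookup (Poly_Mapping.map ((*) r) x) i = r * Poly_Mapping.lookup x i" for i
    by (simp add: Poly_Mapping.map.rep_eq when_def)
  then show ?thesis
    by (simp add: V_quad_def sum_distrib_left power_mult_distrib distrib_left power2_eq_square ac_simps)
qed

lemma V_quad_basis:
  assumes "i \<le> m"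
  shows "V_quad m (Poly_Mapping.single i 1) = (if i = 0 then 1 else s_pow (- 2))"
proof -
  have "V_quad m (Poly_Mapping.single i 1) = (\<Sum>k\<in>{0..m}. if k = i then (if i = 0 then 1 else s_pow (- 2)) else 0)
      + (\<Sum>i'\<in>{0..m}. \<Sum>j\<in>{0..<i'}. 0)"
    unfolding V_quad_def by (intro arg_cong2[of _ _ _ _ "(+)"] sum.cong) (auto simp: lookup_single when_def)
  then show ?thesis using assms by simp
qed

abbreviation V_Cl :: "nat \<Rightarrow> (nat tword \<Rightarrow>\<^sub>0 laurent) set ring"
  where "V_Cl m \<equiv> clifford_algebra {0..m} (V_quad m)"

abbreviation V_Pin :: "nat \<Rightarrow> (nat tword \<Rightarrow>\<^sub>0 laurent) set monoid"
  where "V_Pin m \<equiv> pin_group {0..m} (V_quad m)"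

abbreviation V_vec :: "nat \<Rightarrow> (nat \<Rightarrow>\<^sub>0 laurent) \<Rightarrow> (nat tword \<Rightarrow>\<^sub>0 laurent) set"
  where "V_vec m \<equiv> cl_vec {0..m} (V_quad m)"

abbreviation V_scal :: "nat \<Rightarrow> laurent \<Rightarrow> (nat tword \<Rightarrow>\<^sub>0 laurent) set"
  where "V_scal m \<equiv> cl_scal {0..m} (V_quad m)"

end

theory Submission
  imports Defs
begin

text \<open>
  The prescribed images satisfy the defining relations because of three computations in the Clifford
  algebra. Let $w_{ij} = v_i + v_j$; then $q(w_{ij}) = 1$ and $w_{ij} \perp u$, while $q(u) = 1$.
  
  Symmetric group. Conjugation by a vector $w$ with $q(w) = 1$ is the reflection
  $x \mapsto x + (x, w) w$, and the reflection in $w_{ij}$ swaps $v_i$ and $v_j$ and fixes the other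
  $v_k$. So the elements $u w_{ij}$ are involutions which conjugate one another as the
  transpositions $(i\,j)$ do, and this forces $(i\,j) \mapsto u w_{ij}$ to extend to a
  homomorphism on $S_m$ (\<open>sym_group_hom_of_transpositions\<close>, \<open>cl_swap_conj\<close>). The image of $s_i$ is
  $u \cdot \tilde s_i = u w_{i,i+1}$, as the assignment for $\tilde s_i = \tau s_i$ demands.
  
  Inversion of $a$. The image of $a$ is $\alpha = u \cdot (s v_1)$, a product of two vectors of
  square $1$, so its inverse is $(s v_1) u$. Conjugation by $u$ exchanges the two, and for $i \ge 2$ the
  vector $w_{i,i+1}$ is orthogonal to both factors (\<open>u_cl_a_u\<close>, \<open>cl_swap_cl_a\<close>).
  
  The commutators. The vector $z = u + w_{12}$ is orthogonal to $u$ and $v_1$ and satisfies $q(z) = 0$.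
  Hence $z$ commutes with $u$ and $\alpha$, the image of $s_1$ is $u w_{12} = u (u + z) = 1 + u z$, and its
  conjugate by $p = \alpha^k$ is $1 + u' z$ with $u' = p^{-1} u p$. As $z^2 = 0$, these two
  elements commute (\<open>unipotent_conjugates_commute\<close>, \<open>cl_swap_12_conjugates_commute\<close>).
  
  These relations give a homomorphism $\psi$ into the unit group of the Clifford algebra
  (\<open>yt_group_lift\<close>). The group $\tilde y(m)$ is generated by $\tau$, $a$ and the
  $\tilde s_i$ (\<open>yt_group_generated\<close>), which makes $\psi$ unique. It also places the image of
  $\psi$ in the group generated by the vectors of square $1$, because these contain the images of
  $\tau$ and $\tilde s_i$ and both factors of $\alpha$; that group lies in the Pin group
  (\<open>generate_unit_vectors_pin\<close>).
\<close>

section \<open>Homomorphisms out of symmetric groups\<close>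

text \<open>
  The transpositions of \<open>S\<close>, with conjugation as their only relations besides $t^2 = 1$, present the
  symmetric group on \<open>S\<close>. The proof adds one point \<open>n\<close> at a time: every permutation of \<open>insert n S\<close> is
  uniquely \<open>transpose n k \<circ> r\<close> with \<open>r\<close> fixing \<open>n\<close>, and left multiplication by a transposition can be
  moved past \<open>transpose n k\<close> by a conjugation. Compatibility with left multiplication by transpositions is
  all that multiplicativity needs, so it is the form in which the induction is carried out. The
  convention that \<open>T x x\<close> is the identity matches \<open>transpose x x = id\<close>.
\<close>

lemma (in group) transpositions_extend_to_permutations:
  fixes T :: "'s \<Rightarrow> 's \<Rightarrow> 'a"
  assumes "finite S"
    and closed: "\<And>x y. x \<in> S \<Longrightarrow> y \<in> S \<Longrightarrow> T x y \<in> carrier G"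
    and diag: "\<And>x. x \<in> S \<Longrightarrow> T x x = \<one>"
    and commute: "\<And>x y. x \<in> S \<Longrightarrow> y \<in> S \<Longrightarrow> T x y = T y x"
    and invol: "\<And>x y. x \<in> S \<Longrightarrow> y \<in> S \<Longrightarrow> T x y \<otimes> T x y = \<one>"
    and conj: "\<And>x y z w. \<lbrakk>x \<in> S; y \<in> S; z \<in> S; w \<in> S\<rbrakk> \<Longrightarrow>
      T x y \<otimes> T z w \<otimes> T x y = T (transpose x y z) (transpose x y w)"
  shows "\<exists>\<Phi>. \<Phi> id = \<one> \<and> (\<forall>p. p permutes S \<longrightarrow> \<Phi> p \<in> carrier G) \<and>
    (\<forall>x\<in>S. \<forall>y\<in>S. \<forall>p. p permutes S \<longrightarrow> \<Phi> (transpose x y \<circ> p) = T x y \<otimes> \<Phi> p)"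
  using assms
proof (induction S rule: finite_induct)
  case empty
  then show ?case by (intro exI[of _ "\<lambda>_. \<one>"]) auto
next
  case (insert n S)
  let ?S = "insert n S"
  note T_closed = insert.prems(1) and T_diag = insert.prems(2) and T_commute = insert.prems(3)
    and T_invol = insert.prems(4) and T_conj = insert.prems(5)
  have "\<exists>\<Phi>. \<Phi> id = \<one> \<and> (\<forall>p. p permutes S \<longrightarrow> \<Phi> p \<in> carrier G) \<and>
    (\<forall>x\<in>S. \<forall>y\<in>S. \<forall>p. p permutes S \<longrightarrow> \<Phi> (transpose x y \<circ> p) = T x y \<otimes> \<Phi> p)"
    by (rule insert.IH) (simp_all add: insert.prems)
  then obtain \<Phi> where *: "\<Phi> id = \<one> \<and> (\<forall>p. p permutes S \<longrightarrow> \<Phi> p \<in> carrier G) \<and>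
    (\<forall>x\<in>S. \<forall>y\<in>S. \<forall>p. p permutes S \<longrightarrow> \<Phi> (transpose x y \<circ> p) = T x y \<otimes> \<Phi> p)" ..
  then have \<Phi>_id: "\<Phi> id = \<one>"
    and \<Phi>_closed: "\<And>p. p permutes S \<Longrightarrow> \<Phi> p \<in> carrier G"
    and \<Phi>_step: "\<And>x y p. \<lbrakk>x \<in> S; y \<in> S; p permutes S\<rbrakk> \<Longrightarrow> \<Phi> (transpose x y \<circ> p) = T x y \<otimes> \<Phi> p"
    by simp_all
  define \<Psi> where "\<Psi> p = T n (p n) \<otimes> \<Phi> (transpose n (p n) \<circ> p)" for p
  have \<Psi>_factor: "\<Psi> (transpose n k \<circ> r) = T n k \<otimes> \<Phi> r" if "r permutes S" for k r
  proof -
    have "r n = n" using that insert.hyps(2) by (rule permutes_not_in)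
    then show ?thesis by (simp add: \<Psi>_def flip: o_assoc) (simp add: o_assoc)
  qed
  have swap: "T x y \<otimes> T z w = T (transpose x y z) (transpose x y w) \<otimes> T x y"
    if "x \<in> ?S" "y \<in> ?S" "z \<in> ?S" "w \<in> ?S" for x y z w
  proof -
    have "T x y \<otimes> T z w = (T x y \<otimes> T z w \<otimes> T x y) \<otimes> T x y"
      using that by (simp add: m_assoc T_closed T_invol)
    then show ?thesis using T_conj[OF that] by simp
  qed
  have swap_perm: "transpose x y \<circ> transpose z w = transpose (transpose x y z) (transpose x y w) \<circ> transpose x y"
    for x y z w :: 's by (auto simp: transpose_def fun_eq_iff)
  have "\<Psi> (transpose x y \<circ> q) = T x y \<otimes> \<Psi> q"
    if x: "x \<in> ?S" and y: "y \<in> ?S" and q: "q permutes ?S" for x y q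
  proof -
    define j where "j = q n"
    define r where "r = transpose n j \<circ> q"
    have j: "j \<in> ?S" using permutes_in_image[OF q, of n] by (simp add: j_def)
    have r: "r permutes S" using permutes_insert_lemma[OF q] by (simp add: r_def j_def)
    have q_eq: "q = transpose n j \<circ> r" by (simp add: r_def o_assoc)
    have r_cl: "\<Phi> r \<in> carrier G" by (rule \<Phi>_closed[OF r])
    \<comment> \<open>Multiplication by a transposition that moves \<open>n\<close>. The generic case, with \<open>n\<close>, \<open>j\<close>, \<open>z\<close>
      distinct, is the identity $(n\,z)(n\,j) = (n\,j)(z\,j)$.\<close>
    have main: "\<Psi> (transpose n z \<circ> (transpose n j \<circ> r)) = T n z \<otimes> (T n j \<otimes> \<Phi> r)" if z: "z \<in> ?S" for z
    proof -
      consider "z = n" | "j = n" | "z = j" | "z \<noteq> n" "j \<noteq> n" "z \<noteq> j" by blast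
      then show ?thesis
      proof cases
        case 1
        then show ?thesis using j r_cl by (simp add: \<Psi>_factor[OF r] T_diag T_closed)
      next
        case 2
        then show ?thesis using z r_cl by (simp add: \<Psi>_factor[OF r] T_diag T_closed)
      next
        case 3
        then show ?thesis using z r_cl \<Psi>_factor[OF r, of n]
          by (simp add: o_assoc T_diag T_closed T_invol flip: m_assoc)
      next
        case 4
        then have zj: "z \<in> S" "j \<in> S" using z j by auto
        have "transpose n z \<circ> (transpose n j \<circ> r) = transpose n j \<circ> (transpose z j \<circ> r)"
          using 4 by (auto simp: transpose_def fun_eq_iff)
        moreover have "transpose z j \<circ> r permutes S"
          using r zj by (intro permutes_compose permutes_swap_id)
        ultimately have "\<Psi> (transpose n z \<circ> (transpose n j \<circ> r)) = T n j \<otimes> (T z j \<otimes> \<Phi> r)"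
          by (simp add: \<Psi>_factor \<Phi>_step zj r)
        also have "\<dots> = (T n j \<otimes> T z j) \<otimes> \<Phi> r"
          using z j r_cl by (simp add: T_closed m_assoc)
        also have "T n j \<otimes> T z j = T n z \<otimes> T n j"
          using swap[of n j z j] 4 z j by (simp add: T_commute[of z n])
        also have "(T n z \<otimes> T n j) \<otimes> \<Phi> r = T n z \<otimes> (T n j \<otimes> \<Phi> r)"
          using z j r_cl by (simp add: T_closed m_assoc)
        finally show ?thesis .
      qed
    qed
    show ?thesis
    proof (cases "x = n \<or> y = n")
      case True
      then show ?thesis
      proof
        assume "x = n"
        then show ?thesis using main[OF y] by (simp add: q_eq \<Psi>_factor[OF r])
      next
        assume "y = n"
        then show ?thesis using main[OF x] T_commute[OF x y]
          by (simp add: q_eq \<Psi>_factor[OF r] transpose_commute[of x n])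
      qed
    next
      case False
      then have xy: "x \<in> S" "y \<in> S" using x y by auto
      have n: "transpose x y n = n" using False by (auto simp: transpose_def)
      let ?k = "transpose x y j"
      have k: "?k \<in> ?S" using x y j by (auto simp: transpose_def)
      have "transpose x y \<circ> q = transpose n ?k \<circ> (transpose x y \<circ> r)"
        using swap_perm[of x y n j] by (simp add: q_eq o_assoc n)
      moreover have "transpose x y \<circ> r permutes S"
        using r xy by (intro permutes_compose permutes_swap_id)
      ultimately have "\<Psi> (transpose x y \<circ> q) = T n ?k \<otimes> (T x y \<otimes> \<Phi> r)"
        by (simp add: \<Psi>_factor \<Phi>_step xy r)
      also have "\<dots> = (T n ?k \<otimes> T x y) \<otimes> \<Phi> r" using x y k r_cl by (simp add: m_assoc T_closed)
      also have "T n ?k \<otimes> T x y = T x y \<otimes> T n j"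
        using swap[of x y n j] x y j by (simp add: n)
      also have "(T x y \<otimes> T n j) \<otimes> \<Phi> r = T x y \<otimes> \<Psi> q"
        using x y j r_cl by (simp add: q_eq \<Psi>_factor[OF r] m_assoc T_closed)
      finally show ?thesis .
    qed
  qed
  moreover have "\<Psi> id = \<one>"
    using \<Psi>_factor[OF permutes_id, of n] by (simp add: \<Phi>_id T_diag)
  moreover have "\<Psi> p \<in> carrier G" if "p permutes ?S" for p
  proof -
    have "p n \<in> ?S" using permutes_in_image[OF that, of n] by simp
    then show ?thesis
      unfolding \<Psi>_def by (intro m_closed T_closed \<Phi>_closed permutes_insert_lemma[OF that]) auto
  qed
  ultimately show ?case by blast
qed

lemma (in group) sym_group_hom_of_transpositions:
  fixes T :: "nat \<Rightarrow> nat \<Rightarrow> 'a"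
  assumes closed: "\<And>x y. x \<in> {1..m} \<Longrightarrow> y \<in> {1..m} \<Longrightarrow> T x y \<in> carrier G"
    and diag: "\<And>x. x \<in> {1..m} \<Longrightarrow> T x x = \<one>"
    and commute: "\<And>x y. x \<in> {1..m} \<Longrightarrow> y \<in> {1..m} \<Longrightarrow> T x y = T y x"
    and invol: "\<And>x y. x \<in> {1..m} \<Longrightarrow> y \<in> {1..m} \<Longrightarrow> T x y \<otimes> T x y = \<one>"
    and conj: "\<And>x y z w. \<lbrakk>x \<in> {1..m}; y \<in> {1..m}; z \<in> {1..m}; w \<in> {1..m}\<rbrakk> \<Longrightarrow>
      T x y \<otimes> T z w \<otimes> T x y = T (transpose x y z) (transpose x y w)"
  obtains \<Phi> where "\<Phi> \<in> hom (sym_group m) G"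
    "\<And>x y. x \<in> {1..m} \<Longrightarrow> y \<in> {1..m} \<Longrightarrow> \<Phi> (transpose x y) = T x y"
proof -
  obtain \<Phi> where *: "\<Phi> id = \<one> \<and> (\<forall>p. p permutes {1..m} \<longrightarrow> \<Phi> p \<in> carrier G) \<and>
    (\<forall>x\<in>{1..m}. \<forall>y\<in>{1..m}. \<forall>p. p permutes {1..m} \<longrightarrow> \<Phi> (transpose x y \<circ> p) = T x y \<otimes> \<Phi> p)"
    using transpositions_extend_to_permutations[of "{1..m}" T, OF finite_atLeastAtMost assms] ..
  then have \<Phi>_id: "\<Phi> id = \<one>" and cl: "\<And>p. p permutes {1..m} \<Longrightarrow> \<Phi> p \<in> carrier G"
    and step: "\<And>x y p. \<lbrakk>x \<in> {1..m}; y \<in> {1..m}; p permutes {1..m}\<rbrakk> \<Longrightarrow> \<Phi> (transpose x y \<circ> p) = T x y \<otimes> \<Phi> p"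
    by blast+
  have "\<Phi> (p \<circ> q) = \<Phi> p \<otimes> \<Phi> q" if "p permutes {1..m}" "q permutes {1..m}" for p q
    using that(1) finite_atLeastAtMost
  proof (induction rule: permutes_induct)
    case id
    show ?case using cl[OF that(2)] by (simp only: id_o \<Phi>_id l_one)
  next
    case (swap a b p)
    then have "p \<circ> q permutes {1..m}" using that(2) by (intro permutes_compose)
    then have "\<Phi> (transpose a b \<circ> (p \<circ> q)) = T a b \<otimes> (\<Phi> p \<otimes> \<Phi> q)"
      using swap by (simp only: step)
    also have "\<dots> = \<Phi> (transpose a b \<circ> p) \<otimes> \<Phi> q"
      using swap cl[OF that(2)] by (simp only: step m_assoc closed cl)
    finally show ?case by (simp only: o_assoc)
  qed
  then have "\<Phi> \<in> hom (sym_group m) G"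
    by (intro homI) (simp_all add: sym_group_carrier sym_group_mult cl)
  moreover have "\<Phi> (transpose x y) = T x y" if "x \<in> {1..m}" "y \<in> {1..m}" for x y
    using step[OF that permutes_id] closed[OF that] by (simp add: \<Phi>_id)
  ultimately show thesis using that by blast
qed

lemma sym_group_generated_by_adjacent_transpositions:
  "carrier (sym_group m) = generate (sym_group m) {transpose i (Suc i) | i. 1 \<le> i \<and> i < m}"
proof -
  let ?A = "{transpose i (Suc i) | i :: nat. 1 \<le> i \<and> i < m}"
  let ?H = "generate (sym_group m) ?A"
  interpret S: group "sym_group m" by simp
  have A: "?A \<subseteq> carrier (sym_group m)" by (auto simp: sym_group_carrier intro!: permutes_swap_id)
  have eng: "p \<circ> q \<in> ?H" if "p \<in> ?H" "q \<in> ?H" for p q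
    using generate.eng[OF that] by (simp add: sym_group_mult)
  have adj: "transpose i (Suc i) \<in> ?H" if "1 \<le> i" "i < m" for i
    using that by (intro generate.incl) auto
  have up: "transpose i (i + Suc d) \<in> ?H" if "1 \<le> i" "i + Suc d \<le> m" for i d
    using that
  proof (induction d)
    case 0
    then show ?case using adj by simp
  next
    case (Suc d)
    let ?j = "i + Suc d"
    have "transpose ?j (Suc ?j) \<circ> (transpose i ?j \<circ> transpose ?j (Suc ?j)) \<in> ?H"
      using Suc by (intro eng adj) auto
    moreover have "transpose ?j (Suc ?j) \<circ> (transpose i ?j \<circ> transpose ?j (Suc ?j)) = transpose i (Suc ?j)"
      by (auto simp: transpose_def fun_eq_iff)
    ultimately show ?case by simp
  qed
  have all: "transpose i j \<in> ?H" if "i \<in> {1..m}" "j \<in> {1..m}" "i \<noteq> j" for i j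
    using that up[of i "j - i - 1"] up[of j "i - j - 1"] transpose_commute[of i j]
    by (cases "i < j") auto
  have "p \<in> ?H" if "p permutes {1..m}" for p
    using that finite_atLeastAtMost
  proof (induction rule: permutes_induct)
    case id
    show ?case using generate.one[of "sym_group m" ?A] by (simp only: sym_group_one)
  next
    case (swap a b p)
    then show ?case by (intro eng all)
  qed
  then show ?thesis using S.generate_incl[OF A] by (auto simp: sym_group_carrier)
qed

section \<open>Homomorphisms out of the presented groups\<close>

lemma homs_agree_on_generate:
  assumes G: "group G" and K: "group K" and f: "f \<in> hom G K" and g: "g \<in> hom G K"
    and S: "S \<subseteq> carrier G" and eq: "\<And>x. x \<in> S \<Longrightarrow> f x = g x"
    and x: "x \<in> generate G S"
  shows "f x = g x"
proof -
  interpret f: group_hom G K f by (intro group_hom.intro group_hom_axioms.intro G K f)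
  interpret g: group_hom G K g by (intro group_hom.intro group_hom_axioms.intro G K g)
  show ?thesis using x
  proof (induction rule: generate.induct)
    case (inv h)
    then show ?case using S eq by (simp add: subset_iff)
  next
    case (eng x y)
    then show ?case using f.G.generate_in_carrier[OF S] by simp
  qed (simp_all add: eq)
qed


definition (in group) fp_eval :: "('h \<Rightarrow> 'a) \<Rightarrow> ('k \<Rightarrow> 'a) \<Rightarrow> ('h + 'k) list \<Rightarrow> 'a"
  where "fp_eval f g w = foldr (\<lambda>z x. case_sum f g z \<otimes> x) w \<one>"

lemma (in group) fp_eval_simps [simp]:
  "fp_eval f g [] = \<one>"
  "fp_eval f g (Inl x # w) = f x \<otimes> fp_eval f g w"
  "fp_eval f g (Inr y # w) = g y \<otimes> fp_eval f g w"
  by (simp_all add: fp_eval_def)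

lemma fp_words_induct [consumes 1, case_names Nil Inl Inr]:
  assumes "w \<in> fp_words H K"
    and "P []"
    and "\<And>x w. x \<in> carrier H \<Longrightarrow> w \<in> fp_words H K \<Longrightarrow> P w \<Longrightarrow> P (Inl x # w)"
    and "\<And>y w. y \<in> carrier K \<Longrightarrow> w \<in> fp_words H K \<Longrightarrow> P w \<Longrightarrow> P (Inr y # w)"
  shows "P w"
  using assms(1)
proof (induction w)
  case (Cons z w)
  then show ?case using assms(3,4) by (cases z) auto
qed (rule assms(2))

context group
begin

context
  fixes H :: "('h, 'i) monoid_scheme" and K :: "('k, 'j) monoid_scheme" and f g
  assumes H: "group H" and K: "group K" and f: "f \<in> hom H G" and g: "g \<in> hom K G"
begin

lemma fp_eval_closed: "w \<in> fp_words H K \<Longrightarrow> fp_eval f g w \<in> carrier G"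
  by (induction rule: fp_words_induct) (auto intro: hom_in_carrier[OF f] hom_in_carrier[OF g])

lemma fp_eval_append:
  "w \<in> fp_words H K \<Longrightarrow> w' \<in> fp_words H K \<Longrightarrow> fp_eval f g (w @ w') = fp_eval f g w \<otimes> fp_eval f g w'"
  by (induction rule: fp_words_induct)
    (auto simp: m_assoc fp_eval_closed hom_in_carrier[OF f] hom_in_carrier[OF g])

text \<open>
  Each generating step of \<open>fp_eq\<close> is a multiplication or a deletion inside one factor, which the
  homomorphisms \<open>f\<close> and \<open>g\<close> respect; so evaluation of words is well defined on the free product.
\<close>

lemma fp_eval_cong: "fp_eq H K w w' \<Longrightarrow> fp_eval f g w = fp_eval f g w'"
proof (induction rule: fp_eq.induct)
  case (mult_left u w x y)
  then show ?case
    by (simp add: fp_eval_append fp_eval_closed hom_mult[OF f] m_assoc hom_in_carrier[OF f]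
        group.is_monoid[OF H] monoid.m_closed)
next
  case (mult_right u w x y)
  then show ?case
    by (simp add: fp_eval_append fp_eval_closed hom_mult[OF g] m_assoc hom_in_carrier[OF g]
        group.is_monoid[OF K] monoid.m_closed)
next
  case (one_left u w)
  then show ?case
    by (simp add: fp_eval_append fp_eval_closed hom_one[OF f H is_group] group.is_monoid[OF H])
next
  case (one_right u w)
  then show ?case
    by (simp add: fp_eval_append fp_eval_closed hom_one[OF g K is_group] group.is_monoid[OF K])
qed simp_all

lemma free_product_lift:
  obtains h where "h \<in> hom (free_product H K) G"
    "\<And>w. w \<in> fp_words H K \<Longrightarrow> h (fp_class H K w) = fp_eval f g w"
proof -
  define h where "h X = the_elem (fp_eval f g ` X)" for X
  have h: "h (fp_class H K w) = fp_eval f g w" if "w \<in> fp_words H K" for w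
  proof -
    have "fp_eval f g ` fp_class H K w = {fp_eval f g w}"
      using that fp_eq.refl[OF that] by (auto simp: fp_class_def dest: fp_eval_cong)
    then show ?thesis by (simp add: h_def)
  qed
  have "h \<in> hom (free_product H K) G"
  proof (rule homI)
    fix X assume "X \<in> carrier (free_product H K)"
    then show "h X \<in> carrier G" by (auto simp: free_product_def h fp_eval_closed)
  next
    fix X Y assume "X \<in> carrier (free_product H K)" "Y \<in> carrier (free_product H K)"
    then obtain x y where "x \<in> fp_words H K" "y \<in> fp_words H K" "X = fp_class H K x" "Y = fp_class H K y"
      by (auto simp: free_product_def)
    then show "h (X \<otimes>\<^bsub>free_product H K\<^esub> Y) = h X \<otimes> h Y"
      by (simp add: free_product_mult[OF H K] h fp_eval_append)
  qed
  then show thesis using h that by blast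
qed

end

text \<open>
  Von Dyck's theorem: the kernel of \<open>h\<close> is a normal subgroup containing \<open>S\<close>, hence contains the normal
  closure of \<open>S\<close>.
\<close>

lemma quotient_lift:
  assumes h: "h \<in> hom F G" and F: "group F" and S: "S \<subseteq> carrier F" and one: "\<And>r. r \<in> S \<Longrightarrow> h r = \<one>"
  obtains h' where "h' \<in> hom (F Mod normal_closure F S) G"
    "\<And>x. x \<in> carrier F \<Longrightarrow> h' (normal_closure F S #>\<^bsub>F\<^esub> x) = h x"
proof -
  interpret F: group F by fact
  interpret h: group_hom F G h using h by unfold_locales
  have N: "normal_closure F S \<lhd> F" by (rule normal_closure_normal[OF F S])
  have sub: "subgroup (normal_closure F S) F" using N by (rule normal_imp_subgroup)
  have "normal_closure F S \<subseteq> kernel F G h"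
    by (rule normal_closure_least[OF h.normal_kernel]) (use S one in \<open>auto simp: kernel_def\<close>)
  then have ker: "h n = \<one>" if "n \<in> normal_closure F S" for n using that by (auto simp: kernel_def)
  show thesis
  proof (rule FactGroup_universal[OF h N])
    fix x y assume x: "x \<in> carrier F" and y: "y \<in> carrier F"
      and eq: "normal_closure F S #>\<^bsub>F\<^esub> x = normal_closure F S #>\<^bsub>F\<^esub> y"
    then have "x \<in> normal_closure F S #>\<^bsub>F\<^esub> y" using F.rcos_self[OF x sub] by simp
    then obtain n where n: "n \<in> normal_closure F S" "x = n \<otimes>\<^bsub>F\<^esub> y" unfolding r_coset_def by blast
    then show "h x = h y" using y ker subgroup.subset[OF sub] by (simp add: subset_iff)
  qed (rule that)
qed

end

lemma yt_simps:
  "carrier (yt_group m) = carrier (y_group m) \<times> {0, 1}"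
  "\<one>\<^bsub>yt_group m\<^esub> = (\<one>\<^bsub>y_group m\<^esub>, 0)"
  "(x, k) \<otimes>\<^bsub>yt_group m\<^esub> (y, l) = (x \<otimes>\<^bsub>y_group m\<^esub> (if k = 1 then tau_aut y else y), (k + l) mod 2)"
  by (auto simp: yt_group_def semidirect_product_def carrier_integer_mod_group)

lemma y_group_carrier: "carrier (y_group m) =
    (\<lambda>w. y_kernel m #>\<^bsub>y_free m\<^esub> fp_class integer_group (sym_group m) w)
    ` fp_words integer_group (sym_group m)"
  by (simp add: y_group_def carrier_FactGroup y_free_carrier image_image)

text \<open>
  Evaluation of words gives a homomorphism on $\mathbb Z * S_m$, which kills the relators and so factors
  through $y(m)$. Since conjugation by \<open>t\<close> inverts \<open>a\<close> and centralises the image of $S_m$, it induces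
  on the image what \<open>tau_aut\<close> does on $y(m)$, so the map extends to the semidirect product by
  $\tau \mapsto t$.
\<close>

lemma (in group) yt_group_lift:
  assumes m: "m \<ge> 2" and a: "a \<in> carrier G" and t: "t \<in> carrier G" and tt: "t \<otimes> t = \<one>"
    and ta: "t \<otimes> a \<otimes> t = inv a"
    and \<Phi>: "\<Phi> \<in> hom (sym_group m) G"
    and t\<Phi>: "\<And>p. p permutes {1..m} \<Longrightarrow> t \<otimes> \<Phi> p \<otimes> t = \<Phi> p"
    and rel1: "\<And>k :: int. commutator G (\<Phi> (transpose 1 2)) (conjg G (\<Phi> (transpose 1 2)) (a [^] k)) = \<one>"
    and rel2: "\<And>i. 2 \<le> i \<Longrightarrow> i < m \<Longrightarrow> conjg G a (\<Phi> (transpose i (Suc i))) = inv a"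
  obtains \<psi> where "\<psi> \<in> hom (yt_group m) G" "\<psi> (yt_tau m) = t" "\<psi> (yt_a m) = a"
    "\<And>i. 1 \<le> i \<Longrightarrow> i < m \<Longrightarrow> \<psi> (yt_s m i) = \<Phi> (transpose i (Suc i))"
proof -
  let ?Z = integer_group and ?S = "sym_group m" and ?F = "y_free m" and ?Y = "y_group m"
  let ?W = "fp_words ?Z ?S"
  interpret F: group ?F by (rule y_free_group)
  interpret Y: group ?Y by (rule y_group_group[OF m])
  define A where "A = (\<lambda>k :: int. a [^] k)"
  have A: "A \<in> hom ?Z G" unfolding A_def by (rule hom_integer_group_pow[OF a])
  note ev_closed = fp_eval_closed[OF group_integer_group sym_group_is_group' A \<Phi>]
  note ev_append = fp_eval_append[OF group_integer_group sym_group_is_group' A \<Phi>]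
  obtain h where h: "h \<in> hom ?F G" and hw: "\<And>w. w \<in> ?W \<Longrightarrow> h (fp_class ?Z ?S w) = fp_eval A \<Phi> w"
    using free_product_lift[OF group_integer_group sym_group_is_group' A \<Phi>] by metis
  interpret h: group_hom ?F G h using h by unfold_locales
  have s_perm: "transpose i (Suc i) \<in> carrier ?S" if "1 \<le> i" "i < m" for i
    using that by (auto simp: sym_group_carrier intro!: permutes_swap_id)
  have h_s: "h (free_s m i) = \<Phi> (transpose i (Suc i))" if "1 \<le> i" "i < m" for i
    using s_perm[OF that] hom_in_carrier[OF \<Phi>] unfolding free_s_def by (simp add: hw)
  have h_a: "h (free_a m) = a" using a unfolding free_a_def by (simp add: hw A_def)
  have rel: "h r = \<one>" if r: "r \<in> y_relators m" for r
  proof -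
    from r consider
      (c) k :: int where "r = commutator ?F (free_s m 1) (conjg ?F (free_s m 1) (free_a m [^]\<^bsub>?F\<^esub> k))"
      | (i) i where "r = conjg ?F (free_a m) (free_s m i) \<otimes>\<^bsub>?F\<^esub> free_a m" "2 \<le> i" "i \<le> m - 1"
      unfolding y_relators_def by blast
    then show ?thesis
    proof cases
      case c
      have "free_s m 1 \<in> carrier ?F" "1 < m" using m by (auto intro!: free_s_carrier)
      then have "h r = commutator G (\<Phi> (transpose 1 (Suc 1))) (conjg G (\<Phi> (transpose 1 (Suc 1))) (a [^] k))"
        using h_s[of 1] unfolding c commutator_def conjg_def
        by (simp add: h_a h.hom_int_pow free_a_carrier)
      then show ?thesis using rel1[of k] by (simp add: numeral_2_eq_2)
    next
      case i
      then have "free_s m i \<in> carrier ?F" "1 \<le> i" "i < m" using m by (auto intro!: free_s_carrier)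
      then have "h r = conjg G a (\<Phi> (transpose i (Suc i))) \<otimes> a"
        using h_s[of i] unfolding i commutator_def conjg_def by (simp add: h_a free_a_carrier)
      then show ?thesis using rel2[of i] \<open>i < m\<close> i(2) a by simp
    qed
  qed
  obtain h' where h': "h' \<in> hom ?Y G" and hh: "\<And>X. X \<in> carrier ?F \<Longrightarrow> h' (y_kernel m #>\<^bsub>?F\<^esub> X) = h X"
    using quotient_lift[OF h y_free_group y_relators_carrier[OF m] rel]
    unfolding y_group_def y_kernel_def by blast
  interpret h': group_hom ?Y G h' using h' by unfold_locales
  have tcancel: "t \<otimes> (t \<otimes> x) = x" if "x \<in> carrier G" for x
    using that t tt by (simp flip: m_assoc)
  have inv_t: "inv t = t" using inv_equality[OF tt t t] .
  \<comment> \<open>Conjugation by the involution \<open>t\<close> is an endomorphism, so it is determined on powers by \<open>ta\<close>.\<close>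
  have tA: "t \<otimes> A k \<otimes> t = A (- k)" for k
  proof -
    interpret c: group_hom G G "\<lambda>x. t \<otimes> x \<otimes> t"
      using t by unfold_locales (auto simp: hom_def m_assoc tcancel)
    show ?thesis unfolding A_def using a c.hom_int_pow[OF a, of k] by (simp add: ta int_pow_inv int_pow_neg)
  qed
  have ev_tau: "fp_eval A \<Phi> (tau_word w) = t \<otimes> fp_eval A \<Phi> w \<otimes> t" if "w \<in> ?W" for w
    using that
  proof (induction rule: fp_words_induct)
    case Nil
    then show ?case using t tt by simp
  next
    case (Inl k w)
    then show ?case using t hom_in_carrier[OF A, of k]
      by (simp add: ev_closed m_assoc tcancel flip: tA)
  next
    case (Inr p w)
    have p: "\<Phi> p \<in> carrier G" using Inr(1) by (rule hom_in_carrier[OF \<Phi>])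
    have "fp_eval A \<Phi> (tau_word (Inr p # w)) = (t \<otimes> \<Phi> p \<otimes> t) \<otimes> (t \<otimes> fp_eval A \<Phi> w \<otimes> t)"
      using Inr t\<Phi>[of p] by (simp add: sym_group_carrier)
    also have "\<dots> = t \<otimes> (\<Phi> p \<otimes> fp_eval A \<Phi> w) \<otimes> t"
      using p t Inr(2) by (simp add: m_assoc tcancel ev_closed)
    finally show ?case by simp
  qed
  have h'_tau: "h' (tau_aut x) = t \<otimes> h' x \<otimes> t" if "x \<in> carrier ?Y" for x
  proof -
    from that obtain w where w: "w \<in> ?W" "x = y_kernel m #>\<^bsub>?F\<^esub> fp_class ?Z ?S w"
      unfolding y_group_carrier by blast
    then show ?thesis
      by (simp add: tau_aut_coset[OF m] y_free_carrier tau_word_image_class hh hw ev_tau tau_word_in_words)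
  qed
  define \<psi> where "\<psi> = (\<lambda>(x, k :: int). h' x \<otimes> (if k = 1 then t else \<one>))"
  have tau_cl: "tau_aut x \<in> carrier ?Y" if "x \<in> carrier ?Y" for x
    using hom_in_carrier[OF tau_aut_hom[OF m] that] .
  have "\<psi> \<in> hom (yt_group m) G"
  proof (rule homI)
    fix X assume "X \<in> carrier (yt_group m)"
    then show "\<psi> X \<in> carrier G" using t by (auto simp: yt_simps \<psi>_def)
  next
    fix X Y assume "X \<in> carrier (yt_group m)" "Y \<in> carrier (yt_group m)"
    then obtain x k y l where "X = (x, k)" "Y = (y, l)" "x \<in> carrier ?Y" "y \<in> carrier ?Y"
      "k = 0 \<or> k = 1" "l = 0 \<or> l = 1" unfolding yt_simps by blast
    then show "\<psi> (X \<otimes>\<^bsub>yt_group m\<^esub> Y) = \<psi> X \<otimes> \<psi> Y"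
      using t tt by (elim disjE) (simp_all add: \<psi>_def yt_simps h'_tau tau_cl m_assoc tcancel)
  qed
  moreover have "\<psi> (yt_tau m) = t" using t by (simp add: \<psi>_def yt_tau_def)
  moreover have "\<psi> (yt_a m) = a"
    using a by (simp add: \<psi>_def yt_a_def y_a_def hh free_a_carrier h_a)
  moreover have "\<psi> (yt_s m i) = \<Phi> (transpose i (Suc i))" if "1 \<le> i" "i < m" for i
    using that hom_in_carrier[OF \<Phi> s_perm[OF that]]
    by (simp add: \<psi>_def yt_s_def y_s_def hh free_s_carrier h_s)
  ultimately show thesis using that by blast
qed

lemma yt_tau_simps:
  assumes "m \<ge> 2"
  shows "yt_tau m \<in> carrier (yt_group m)" "yt_tau m \<otimes>\<^bsub>yt_group m\<^esub> yt_tau m = \<one>\<^bsub>yt_group m\<^esub>"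
proof -
  interpret Y: group "y_group m" by (rule y_group_group[OF assms])
  interpret T: group_hom "y_group m" "y_group m" tau_aut
    by (simp add: group_hom_def group_hom_axioms_def Y.is_group tau_aut_hom[OF assms])
  show "yt_tau m \<in> carrier (yt_group m)" "yt_tau m \<otimes>\<^bsub>yt_group m\<^esub> yt_tau m = \<one>\<^bsub>yt_group m\<^esub>"
    by (simp_all add: yt_tau_def yt_simps)
qed

section \<open>Generators of the extended group\<close>

definition yt_word :: "nat \<Rightarrow> (int + (nat \<Rightarrow> nat)) list \<Rightarrow> (int + (nat \<Rightarrow> nat)) list set set \<times> int"
  where "yt_word m w = (y_kernel m #>\<^bsub>y_free m\<^esub> fp_class integer_group (sym_group m) w, 0)"

lemma yt_word_hom:
  assumes "m \<ge> 2" "w \<in> fp_words integer_group (sym_group m)" "w' \<in> fp_words integer_group (sym_group m)"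
  shows "yt_word m w \<in> carrier (yt_group m)"
    and "yt_word m (w @ w') = yt_word m w \<otimes>\<^bsub>yt_group m\<^esub> yt_word m w'"
proof -
  interpret N: normal "y_kernel m" "y_free m" by (rule y_kernel_normal[OF assms(1)])
  show "yt_word m w \<in> carrier (yt_group m)"
    using assms by (auto simp: yt_word_def yt_simps y_group_carrier)
  show "yt_word m (w @ w') = yt_word m w \<otimes>\<^bsub>yt_group m\<^esub> yt_word m w'"
    using assms by (simp add: yt_word_def yt_simps y_group_def y_free_carrier N.rcos_sum free_product_mult)
qed

lemma yt_s_word: "yt_s m i = yt_word m [Inr (transpose i (Suc i))]"
  by (simp add: yt_s_def y_s_def free_s_def yt_word_def)

lemma yt_s_closed: "1 \<le> i \<Longrightarrow> i < m \<Longrightarrow> yt_s m i \<in> carrier (yt_group m)"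
  unfolding yt_s_word
  by (intro yt_word_hom(1)[where w' = "[]"]) (auto simp: sym_group_carrier intro!: permutes_swap_id)

text \<open>
  The factors $\mathbb Z$ and $S_m$ map into $\tilde y(m)$ with images generated by $a$ and by the
  $s_i = \tau \tilde s_i$; the classes of words are products of such images, and $\tau$ supplies the
  other coset of $y(m)$.
\<close>

lemma yt_group_generated:
  assumes m: "m \<ge> 2"
  shows "carrier (yt_group m) = generate (yt_group m) ({yt_tau m, yt_a m} \<union> {yt_st m i | i. 1 \<le> i \<and> i < m})"
    (is "_ = generate _ ?X")
    and "{yt_tau m, yt_a m} \<union> {yt_st m i | i. 1 \<le> i \<and> i < m} \<subseteq> carrier (yt_group m)"
proof -
  let ?Z = integer_group and ?S = "sym_group m" and ?G = "yt_group m"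
  let ?W = "fp_words ?Z ?S" and ?H = "generate ?G ?X"
  interpret G: group ?G by (rule yt_group_group[OF m])
  note tau = yt_tau_simps[OF m]
  have a_word: "yt_a m = yt_word m [Inl 1]" by (simp add: yt_a_def y_a_def free_a_def yt_word_def)
  have s_perm: "transpose i (Suc i) \<in> carrier ?S" if "1 \<le> i" "i < m" for i
    using that by (auto simp: sym_group_carrier intro!: permutes_swap_id)
  show X: "?X \<subseteq> carrier ?G"
    using tau yt_s_closed by (auto simp: a_word yt_st_def intro!: G.m_closed yt_word_hom(1)[where w' = "[]"] m)
  have H: "subgroup ?H ?G" by (rule G.generate_is_subgroup[OF X])
  have tau_H: "yt_tau m \<in> ?H" and a_H: "yt_a m \<in> ?H" by (auto intro: generate.incl)
  have s_H: "yt_s m i \<in> ?H" if "1 \<le> i" "i < m" for i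
  proof -
    have "yt_tau m \<otimes>\<^bsub>?G\<^esub> yt_st m i \<in> ?H" using that tau_H by (intro generate.eng) (auto intro: generate.incl)
    moreover have "yt_tau m \<otimes>\<^bsub>?G\<^esub> yt_st m i = yt_s m i"
      using tau yt_s_closed[OF that] by (simp add: yt_st_def flip: G.m_assoc)
    ultimately show ?thesis by simp
  qed
  have word_cong: "yt_word m w = yt_word m w'" if "fp_eq ?Z ?S w w'" for w w'
    using fp_class_eqI[OF that] by (simp add: yt_word_def)
  have Z_hom: "(\<lambda>k. yt_word m [Inl k]) \<in> hom ?Z ?G"
    using fp_eq.mult_left[of "[]" ?Z ?S "[]", THEN word_cong] yt_word_hom(2)[OF m, of "[Inl _]" "[Inl _]"]
    by (intro homI) (auto intro!: yt_word_hom(1)[where w' = "[]"] m)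
  have S_hom: "(\<lambda>p. yt_word m [Inr p]) \<in> hom ?S ?G"
    using fp_eq.mult_right[of "[]" ?Z ?S "[]", THEN word_cong] yt_word_hom(2)[OF m, of "[Inr _]" "[Inr _]"]
    by (intro homI) (auto intro!: yt_word_hom(1)[where w' = "[]"] m)
  interpret Z: group_hom ?Z ?G "\<lambda>k. yt_word m [Inl k]" 
    by (intro group_hom.intro group_hom_axioms.intro group_integer_group G.is_group Z_hom)
  interpret S: group_hom ?S ?G "\<lambda>p. yt_word m [Inr p]" 
    by (intro group_hom.intro group_hom_axioms.intro sym_group_is_group' G.is_group S_hom)
  have Z_H: "yt_word m [Inl k] \<in> ?H" for k
  proof -
    have "generate ?G ((\<lambda>k. yt_word m [Inl k]) ` {1}) \<subseteq> ?H"
      using a_H by (intro G.generate_subgroup_incl H) (simp add: a_word)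
    moreover have "k \<in> generate ?Z {1}"
      using group.generate_pow[OF group_integer_group, of 1] by simp
    ultimately show ?thesis using Z.generate_img[of "{1}"] by auto
  qed
  have S_H: "yt_word m [Inr p] \<in> ?H" if "p \<in> carrier ?S" for p
  proof -
    let ?A = "{transpose i (Suc i) | i :: nat. 1 \<le> i \<and> i < m}"
    have "generate ?G ((\<lambda>p. yt_word m [Inr p]) ` ?A) \<subseteq> ?H"
      using s_H by (intro G.generate_subgroup_incl H) (auto simp: yt_s_word)
    moreover have "?A \<subseteq> carrier ?S" using s_perm by auto
    ultimately show ?thesis
      using that S.generate_img[of ?A] sym_group_generated_by_adjacent_transpositions[of m] by blast
  qed
  have word_H: "yt_word m w \<in> ?H" if "w \<in> ?W" for w
    using that
  proof (induction rule: fp_words_induct)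
    case Nil
    show ?case using word_cong[OF fp_eq.one_left[of "[]" ?Z ?S "[]"]] Z_H[of 0] by simp
  next
    case (Inl x w)
    then show ?case using yt_word_hom(2)[OF m, of "[Inl x]" w] generate.eng[OF Z_H] by simp
  next
    case (Inr y w)
    then show ?case using yt_word_hom(2)[OF m, of "[Inr y]" w] generate.eng[OF S_H] by simp
  qed
  have "x \<in> ?H" if "x \<in> carrier ?G" for x
  proof -
    obtain w k where w: "w \<in> ?W" and x: "x = (fst (yt_word m w), k)" and k: "k = 0 \<or> k = 1"
    proof -
      obtain y k where "x = (y, k)" "y \<in> carrier (y_group m)" "k = 0 \<or> k = 1"
        using \<open>x \<in> carrier ?G\<close> unfolding yt_simps by blast
      then show thesis using that[of _ k] unfolding y_group_carrier yt_word_def by auto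
    qed
    from k show ?thesis
    proof
      assume "k = 0"
      then have "x = yt_word m w" by (simp add: x yt_word_def)
      then show ?thesis using word_H[OF w] by simp
    next
      assume "k = 1"
      interpret Y: group "y_group m" by (rule y_group_group[OF m])
      interpret T: group_hom "y_group m" "y_group m" tau_aut
        by (simp add: group_hom_def group_hom_axioms_def Y.is_group tau_aut_hom[OF m])
      have "fst (yt_word m w) \<in> carrier (y_group m)" using w by (auto simp: yt_word_def y_group_carrier)
      then have "x = yt_word m w \<otimes>\<^bsub>?G\<^esub> yt_tau m"
        using \<open>k = 1\<close> by (simp add: x yt_word_def yt_tau_def yt_simps)
      then show ?thesis using generate.eng[OF word_H[OF w] tau_H] by simp
    qed
  qed
  then show "carrier ?G = ?H" using G.generate_incl[OF X] by blast
qed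

section \<open>Clifford algebras and Pin groups\<close>

lemma cl_proj_ring_hom:
  "(+>\<^bsub>tensor_algebra B\<^esub>) (clifford_ideal B q) \<in> ring_hom (tensor_algebra B) (clifford_algebra B q)"
  unfolding clifford_algebra_def by (rule ideal.rcos_ring_hom[OF clifford_ideal_ideal])

lemma cl_scal_closed: "cl_scal B q r \<in> carrier (clifford_algebra B q)"
  unfolding cl_scal_def by (intro ring_hom_closed[OF cl_proj_ring_hom] tscal_carrier)

lemma cl_vec_closed: "x \<in> free_module B \<Longrightarrow> cl_vec B q x \<in> carrier (clifford_algebra B q)"
  unfolding cl_vec_def by (intro ring_hom_closed[OF cl_proj_ring_hom] tvec_carrier)

lemma clifford_carrierE:
  assumes "X \<in> carrier (clifford_algebra B q)"
  obtains p where "p \<in> carrier (tensor_algebra B)" "X = clifford_ideal B q +>\<^bsub>tensor_algebra B\<^esub> p"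
  using assms unfolding clifford_algebra_def FactRing_simps by auto

lemma cl_rev_closed: "X \<in> carrier (clifford_algebra B q) \<Longrightarrow> cl_rev X \<in> carrier (clifford_algebra B q)"
  by (elim clifford_carrierE)
    (simp add: cl_rev_coset ring_hom_closed[OF cl_proj_ring_hom] trev_carrier del: tensor_algebra_simps(1))

lemma cl_scal_one: "cl_scal B q 1 = \<one>\<^bsub>clifford_algebra B q\<^esub>"
  using ring_hom_one[OF cl_proj_ring_hom, of B q] by (simp add: cl_scal_def tscal_def single_one)

lemma cl_scal_zero: "cl_scal B q 0 = \<zero>\<^bsub>clifford_algebra B q\<^esub>"
  using ring_hom_zero[OF cl_proj_ring_hom tensor_algebra_ring clifford_algebra_ring, of B q]
  by (simp add: cl_scal_def tscal_def)

lemma cl_scal_add: "cl_scal B q (r + r') = cl_scal B q r \<oplus>\<^bsub>clifford_algebra B q\<^esub> cl_scal B q r'"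
  using ring_hom_add[OF cl_proj_ring_hom tscal_carrier tscal_carrier, of B q r r']
  by (simp add: cl_scal_def tscal_def single_add)

lemma cl_vec_add:
  assumes "x \<in> free_module B" "y \<in> free_module B"
  shows "cl_vec B q (x + y) = cl_vec B q x \<oplus>\<^bsub>clifford_algebra B q\<^esub> cl_vec B q y"
  using ring_hom_add[OF cl_proj_ring_hom tvec_carrier[OF assms(1)] tvec_carrier[OF assms(2)], of q]
  by (simp add: cl_vec_def tvec_add)

lemma cl_vec_scale:
  assumes "x \<in> free_module B"
  shows "cl_vec B q (Poly_Mapping.map ((*) r) x) = cl_scal B q r \<otimes>\<^bsub>clifford_algebra B q\<^esub> cl_vec B q x"
  using ring_hom_mult[OF cl_proj_ring_hom tscal_carrier tvec_carrier[OF assms], of q r]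
  by (simp add: cl_vec_def cl_scal_def tvec_scale)

lemma cl_scal_central:
  assumes "X \<in> carrier (clifford_algebra B q)"
  shows "cl_scal B q r \<otimes>\<^bsub>clifford_algebra B q\<^esub> X = X \<otimes>\<^bsub>clifford_algebra B q\<^esub> cl_scal B q r"
proof -
  obtain p where p: "p \<in> carrier (tensor_algebra B)" "X = clifford_ideal B q +>\<^bsub>tensor_algebra B\<^esub> p"
    using assms by (rule clifford_carrierE)
  have "tscal r \<otimes>\<^bsub>tensor_algebra B\<^esub> p = p \<otimes>\<^bsub>tensor_algebra B\<^esub> tscal r"
    by (simp add: tscal_central)
  then show ?thesis
    using ring_hom_mult[OF cl_proj_ring_hom tscal_carrier p(1), of q r]
      ring_hom_mult[OF cl_proj_ring_hom p(1) tscal_carrier, of q r]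
    by (simp only: p(2) cl_scal_def)
qed

lemma free_module_add: "x \<in> free_module B \<Longrightarrow> y \<in> free_module B \<Longrightarrow> x + y \<in> free_module B"
  unfolding free_module_def using keys_add[of x y] by auto

lemma free_module_scale: "x \<in> free_module B \<Longrightarrow> Poly_Mapping.map ((*) r) x \<in> free_module B"
  for r :: "'r::comm_ring_1"
  unfolding free_module_def by (auto simp: in_keys_iff Poly_Mapping.map.rep_eq when_def subset_iff)

lemma clifford_group_set_mult:
  assumes "c \<in> clifford_group_set B q" "d \<in> clifford_group_set B q"
  shows "c \<otimes>\<^bsub>clifford_algebra B q\<^esub> d \<in> clifford_group_set B q"
proof -
  interpret Cl: ring "clifford_algebra B q" by (rule clifford_algebra_ring)
  have cd: "c \<in> Units (clifford_algebra B q)" "d \<in> Units (clifford_algebra B q)"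
    using assms by (simp_all add: clifford_group_set_def)
  have "inv\<^bsub>clifford_algebra B q\<^esub> (c \<otimes>\<^bsub>clifford_algebra B q\<^esub> d) \<otimes>\<^bsub>clifford_algebra B q\<^esub> v
      \<otimes>\<^bsub>clifford_algebra B q\<^esub> (c \<otimes>\<^bsub>clifford_algebra B q\<^esub> d) \<in> cl_vec B q ` free_module B"
    if v: "v \<in> cl_vec B q ` free_module B" for v
  proof -
    have vc: "v \<in> carrier (clifford_algebra B q)" using v by (auto intro: cl_vec_closed)
    have "inv\<^bsub>clifford_algebra B q\<^esub> d \<otimes>\<^bsub>clifford_algebra B q\<^esub> (inv\<^bsub>clifford_algebra B q\<^esub> c \<otimes>\<^bsub>clifford_algebra B q\<^esub> v
      \<otimes>\<^bsub>clifford_algebra B q\<^esub> c) \<otimes>\<^bsub>clifford_algebra B q\<^esub> d \<in> cl_vec B q ` free_module B"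
      using assms v unfolding clifford_group_set_def by blast
    moreover have "inv\<^bsub>clifford_algebra B q\<^esub> (c \<otimes>\<^bsub>clifford_algebra B q\<^esub> d)
      = inv\<^bsub>clifford_algebra B q\<^esub> d \<otimes>\<^bsub>clifford_algebra B q\<^esub> inv\<^bsub>clifford_algebra B q\<^esub> c"
      using group.inv_mult_group[OF Cl.units_group, of c d] cd
      by (simp add: units_of_carrier units_of_mult Cl.units_of_inv Cl.Units_m_closed)
    ultimately show ?thesis using cd vc by (simp add: Cl.m_assoc Cl.Units_closed)
  qed
  then show ?thesis using cd by (simp add: clifford_group_set_def)
qed

text \<open>
  Products are immediate, but inverses are not, since $c^{-1} V c \subseteq V$ does not by itself give
  $c V c^{-1} \subseteq V$. For this reason membership in the Pin group is derived below for a group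
  generated by involutions, whose elements are products of these.
\<close>

lemma pin_set_mult:
  assumes "c \<in> pin_set B q" "d \<in> pin_set B q"
  shows "c \<otimes>\<^bsub>clifford_algebra B q\<^esub> d \<in> pin_set B q"
proof -
  interpret Cl: ring "clifford_algebra B q" by (rule clifford_algebra_ring)
  have c: "c \<in> carrier (clifford_algebra B q)" and d: "d \<in> carrier (clifford_algebra B q)"
    using assms by (auto simp: pin_set_def clifford_group_set_def)
  have "(c \<otimes>\<^bsub>clifford_algebra B q\<^esub> d) \<otimes>\<^bsub>clifford_algebra B q\<^esub> cl_rev (c \<otimes>\<^bsub>clifford_algebra B q\<^esub> d)
    = c \<otimes>\<^bsub>clifford_algebra B q\<^esub> (d \<otimes>\<^bsub>clifford_algebra B q\<^esub> cl_rev d) \<otimes>\<^bsub>clifford_algebra B q\<^esub> cl_rev c"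
    using c d by (simp add: cl_rev_mult cl_rev_closed Cl.m_assoc)
  also have "\<dots> = \<one>\<^bsub>clifford_algebra B q\<^esub>"
    using assms c by (simp add: pin_set_def)
  finally show ?thesis using assms by (simp add: pin_set_def clifford_group_set_mult)
qed

text \<open>
  Since $z$ commutes with $u$ and $p$ and has square $0$, the element $c = 1 + u z$
  and its conjugate $1 + u' z$, with $u' = p^{-1} u p$, multiply to $1 + u z + u' z$ in either order.
\<close>

lemma (in ring) unipotent_conjugates_commute:
  assumes p: "p \<in> Units R" and u: "u \<in> carrier R" and z: "z \<in> carrier R"
    and zz: "z \<otimes> z = \<zero>" and uz: "u \<otimes> z = z \<otimes> u" and pz: "p \<otimes> z = z \<otimes> p"
  defines "c \<equiv> \<one> \<oplus> u \<otimes> z"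
  shows "c \<otimes> (inv p \<otimes> c \<otimes> p) = (inv p \<otimes> c \<otimes> p) \<otimes> c"
proof -
  define u' where "u' = inv p \<otimes> u \<otimes> p"
  have pc: "p \<in> carrier R" "inv p \<in> carrier R" using p by auto
  have u': "u' \<in> carrier R" using pc u by (simp add: u'_def)
  have ipz: "inv p \<otimes> z = z \<otimes> inv p"
  proof -
    have "inv p \<otimes> z = inv p \<otimes> (z \<otimes> p) \<otimes> inv p" using p pc z by (simp add: m_assoc)
    also have "\<dots> = inv p \<otimes> (p \<otimes> z) \<otimes> inv p" by (simp only: pz)
    also have "\<dots> = (inv p \<otimes> p) \<otimes> z \<otimes> inv p" using pc z by (simp add: m_assoc)
    finally show ?thesis using p pc z by simp
  qed
  have "inv p \<otimes> c \<otimes> p = inv p \<otimes> p \<oplus> inv p \<otimes> (u \<otimes> (z \<otimes> p))"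
    using pc u z by (simp add: c_def l_distr r_distr m_assoc)
  also have "\<dots> = \<one> \<oplus> u' \<otimes> z"
    using p pc u z by (simp add: u'_def m_assoc flip: pz)
  finally have c': "inv p \<otimes> c \<otimes> p = \<one> \<oplus> u' \<otimes> z" .
  have vanish: "(x \<otimes> z) \<otimes> (y \<otimes> z) = \<zero>" if "x \<in> carrier R" "y \<in> carrier R" "y \<otimes> z = z \<otimes> y" for x y
  proof -
    have "(x \<otimes> z) \<otimes> (y \<otimes> z) = x \<otimes> (z \<otimes> z) \<otimes> y" using that z by (simp add: m_assoc)
    then show ?thesis using that by (simp add: zz)
  qed
  have "u' \<otimes> z = inv p \<otimes> (u \<otimes> (p \<otimes> z))" using pc u z by (simp add: u'_def m_assoc)
  also have "\<dots> = inv p \<otimes> ((u \<otimes> z) \<otimes> p)" using pc u z by (simp add: pz m_assoc)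
  also have "\<dots> = (inv p \<otimes> z) \<otimes> (u \<otimes> p)" using pc u z by (simp add: uz m_assoc)
  also have "\<dots> = z \<otimes> u'" using pc u z by (simp add: ipz u'_def m_assoc)
  finally have u'z: "u' \<otimes> z = z \<otimes> u'" .
  show ?thesis
    unfolding c' unfolding c_def using u u' z vanish[OF u u' u'z] vanish[OF u' u uz]
    by (simp add: l_distr r_distr a_ac)
qed

lemma (in group) commutator_eq_one:
  "x \<in> carrier G \<Longrightarrow> y \<in> carrier G \<Longrightarrow> x \<otimes> y = y \<otimes> x \<Longrightarrow> commutator G x y = \<one>"
  by (simp add: commutator_def m_assoc) (simp flip: m_assoc)

section \<open>Reflections in unit vectors of $V$\<close>

lemma V_form_add_left: "V_form m (x + y) z = V_form m x z + V_form m y z"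
  by (simp add: V_form_def lookup_add distrib_right sum.distrib)

lemma V_form_add_right: "V_form m x (y + z) = V_form m x y + V_form m x z"
  by (simp add: V_form_def lookup_add distrib_left sum.distrib)

lemma vec_mem: "i \<le> m \<Longrightarrow> Poly_Mapping.single i (1::laurent) \<in> free_module {0..m}" for i m :: nat
  by (simp add: free_module_def)

text \<open>
  The basis vector $u$ has index \<open>0\<close>, so it is the one of the convolution product on
  \<open>nat \<Rightarrow>\<^sub>0 laurent\<close>; the simplifier writes it as \<open>1\<close>, and the lemmas about $u$ are stated in this form.
\<close>

lemma V_quad_u: "V_quad m 1 = 1"
  using V_quad_basis[of 0 m] by simp

lemma V_form_u: "i \<in> {1..m} \<Longrightarrow> V_form m 1 (vec_v i) = 1"
  using V_form_basis[of 0 m i] by simp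

lemma vec_u_mem: "1 \<in> (free_module {0..m} :: (nat \<Rightarrow>\<^sub>0 laurent) set)"
  using vec_mem[of 0 m] by simp

lemma V_module_double: "x + x = 0" for x :: "nat \<Rightarrow>\<^sub>0 laurent"
  by (rule poly_mapping_eqI) (simp only: lookup_add laurent_double lookup_zero)

lemma V_module_two [simp]: "(2 :: nat \<Rightarrow>\<^sub>0 laurent) = 0"
  using V_module_double[of 1] by (simp only: one_add_one)

context
  fixes m :: nat
begin

interpretation Cl: ring "V_Cl m" by (rule clifford_algebra_ring)

abbreviation (input) cl_times (infixl "\<cdot>" 70) where "x \<cdot> y \<equiv> x \<otimes>\<^bsub>V_Cl m\<^esub> y"
abbreviation (input) cl_plus (infixl "\<boxplus>" 65) where "x \<boxplus> y \<equiv> x \<oplus>\<^bsub>V_Cl m\<^esub> y"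
abbreviation (input) "V_mod \<equiv> (free_module {0..m} :: (nat \<Rightarrow>\<^sub>0 laurent) set)"

lemma V_Cl_double: "X \<in> carrier (V_Cl m) \<Longrightarrow> X \<boxplus> X = \<zero>\<^bsub>V_Cl m\<^esub>"
proof -
  assume X: "X \<in> carrier (V_Cl m)"
  have "\<one>\<^bsub>V_Cl m\<^esub> \<boxplus> \<one>\<^bsub>V_Cl m\<^esub> = \<zero>\<^bsub>V_Cl m\<^esub>"
    using cl_scal_add[of "{0..m}" "V_quad m" 1 1] by (simp add: cl_scal_one cl_scal_zero)
  then have "(\<one>\<^bsub>V_Cl m\<^esub> \<boxplus> \<one>\<^bsub>V_Cl m\<^esub>) \<cdot> X = \<zero>\<^bsub>V_Cl m\<^esub>" using X by simp
  then show ?thesis using X by (simp add: Cl.l_distr)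
qed

text \<open>
  Polarisation of $w^2 = q(w)$ at $w = x + y$; signs do not matter in characteristic $2$.
\<close>

lemma V_vec_swap:
  assumes x: "x \<in> V_mod" and y: "y \<in> V_mod"
  shows "V_vec m x \<cdot> V_vec m y = V_vec m y \<cdot> V_vec m x \<boxplus> V_scal m (V_form m x y)"
proof -
  let ?x = "V_vec m x" and ?y = "V_vec m y" and ?f = "V_scal m (V_form m x y)"
  note c = cl_vec_closed[OF x, of "V_quad m"] cl_vec_closed[OF y, of "V_quad m"] cl_scal_closed[of "{0..m}" "V_quad m"]
  have "(?x \<boxplus> ?y) \<cdot> (?x \<boxplus> ?y) = V_scal m (V_quad m x) \<boxplus> V_scal m (V_quad m y) \<boxplus> ?f"
    using cl_vec_square[OF free_module_add[OF x y], of "V_quad m"]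
    by (simp add: cl_vec_add x y V_quad_add cl_scal_add)
  also have "\<dots> = ?x \<cdot> ?x \<boxplus> ?y \<cdot> ?y \<boxplus> ?f" by (simp add: cl_vec_square x y)
  finally have "(?x \<cdot> ?y \<boxplus> ?y \<cdot> ?x) \<boxplus> (?x \<cdot> ?x \<boxplus> ?y \<cdot> ?y) = ?f \<boxplus> (?x \<cdot> ?x \<boxplus> ?y \<cdot> ?y)"
    using c by (simp add: Cl.l_distr Cl.r_distr Cl.a_ac)
  then have "?x \<cdot> ?y \<boxplus> ?y \<cdot> ?x = ?f"
    using c by (simp only: Cl.add.right_cancel Cl.add.m_closed Cl.m_closed)
  then have "?x \<cdot> ?y \<boxplus> (?y \<cdot> ?x \<boxplus> ?y \<cdot> ?x) = ?f \<boxplus> ?y \<cdot> ?x"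
    using c by (simp flip: Cl.a_assoc)
  then show ?thesis using c by (simp add: V_Cl_double Cl.a_comm)
qed

lemma orthogonal_commute:
  assumes "x \<in> V_mod" "y \<in> V_mod" "V_form m x y = 0"
  shows "V_vec m x \<cdot> V_vec m y = V_vec m y \<cdot> V_vec m x"
  using V_vec_swap[OF assms(1,2)] assms by (simp add: cl_scal_zero cl_vec_closed)

lemma unit_square:
  assumes "w \<in> V_mod" "V_quad m w = 1"
  shows "V_vec m w \<cdot> V_vec m w = \<one>\<^bsub>V_Cl m\<^esub>"
  using cl_vec_square[OF assms(1), of "V_quad m"] assms(2) by (simp add: cl_scal_one)

text \<open>
  By polarisation $w x = x w + (w, x)$, and then $w^2 = 1$.
\<close>

lemma reflection:
  assumes w: "w \<in> V_mod" "V_quad m w = 1" and x: "x \<in> V_mod"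
  shows "V_vec m w \<cdot> V_vec m x \<cdot> V_vec m w = V_vec m (x + Poly_Mapping.map ((*) (V_form m w x)) w)"
proof -
  note c = cl_vec_closed[OF w(1), of "V_quad m"] cl_vec_closed[OF x, of "V_quad m"] cl_scal_closed[of "{0..m}" "V_quad m"]
  have "V_vec m w \<cdot> V_vec m x \<cdot> V_vec m w
      = V_vec m x \<cdot> (V_vec m w \<cdot> V_vec m w) \<boxplus> V_scal m (V_form m w x) \<cdot> V_vec m w"
    unfolding V_vec_swap[OF w(1) x] using c by (simp add: Cl.l_distr Cl.m_assoc)
  then show ?thesis
    using c by (simp add: unit_square w x cl_vec_add cl_vec_scale free_module_scale)
qed

definition unit_vectors :: "(nat tword \<Rightarrow>\<^sub>0 laurent) set set"
  where "unit_vectors = V_vec m ` {w \<in> V_mod. V_quad m w = 1}"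

lemma unit_vector_Units:
  assumes "w \<in> V_mod" "V_quad m w = 1"
  shows "V_vec m w \<in> Units (V_Cl m)" "inv\<^bsub>V_Cl m\<^esub> V_vec m w = V_vec m w"
proof -
  note c = cl_vec_closed[OF assms(1), of "V_quad m"] and s = unit_square[OF assms]
  show "V_vec m w \<in> Units (V_Cl m)" unfolding Units_def using c s by blast
  show "inv\<^bsub>V_Cl m\<^esub> V_vec m w = V_vec m w" using c s by (intro Cl.inv_unique'[symmetric])
qed

text \<open>
  A unit vector is its own inverse and its own reversal, and the reflection in it preserves $V$.
\<close>

lemma unit_vector_pin:
  assumes w: "w \<in> V_mod" "V_quad m w = 1"
  shows "V_vec m w \<in> pin_set {0..m} (V_quad m)"
proof -
  have "V_vec m w \<cdot> V_vec m x \<cdot> V_vec m w \<in> V_vec m ` V_mod" if "x \<in> V_mod" for x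
    unfolding reflection[OF w that] by (intro imageI free_module_add free_module_scale w that)
  then show ?thesis
    using unit_vector_Units[OF w]
    by (auto simp: pin_set_def clifford_group_set_def cl_rev_cl_vec unit_square w)
qed

text \<open>
  Unit vectors are involutions, so the group that they generate consists of products of unit vectors,
  and the Pin group is closed under products.
\<close>

lemma generate_unit_vectors_pin: "generate (units_of (V_Cl m)) unit_vectors \<subseteq> pin_set {0..m} (V_quad m)"
proof
  fix c assume "c \<in> generate (units_of (V_Cl m)) unit_vectors"
  then show "c \<in> pin_set {0..m} (V_quad m)"
  proof (induction rule: generate.induct)
    case one
    \<comment> \<open>The identity is $u^2$.\<close>
    have "V_vec m 1 \<cdot> V_vec m 1 \<in> pin_set {0..m} (V_quad m)"
      by (intro pin_set_mult unit_vector_pin vec_u_mem V_quad_u)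
    then show ?case by (simp add: units_of_one unit_square vec_u_mem V_quad_u)
  next
    case (incl h)
    then show ?case by (auto simp: unit_vectors_def unit_vector_pin)
  next
    case (inv h)
    then show ?case by (auto simp: unit_vectors_def unit_vector_pin Cl.units_of_inv unit_vector_Units)
  next
    case (eng c d)
    then show ?case by (simp add: units_of_mult pin_set_mult)
  qed
qed

section \<open>The symmetric group in the Clifford algebra\<close>

text \<open>
  The vectors $v_i + v_j$ play the role of the roots $\epsilon_i - \epsilon_j$ of the symmetric group.
\<close>

definition root_vec :: "nat \<Rightarrow> nat \<Rightarrow> (nat \<Rightarrow>\<^sub>0 laurent)"
  where "root_vec i j = vec_v i + vec_v j"

lemma root_mem: "i \<in> {1..m} \<Longrightarrow> j \<in> {1..m} \<Longrightarrow> root_vec i j \<in> V_mod"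
  unfolding root_vec_def by (intro free_module_add vec_mem) auto

lemma root_quad: "i \<in> {1..m} \<Longrightarrow> j \<in> {1..m} \<Longrightarrow> i \<noteq> j \<Longrightarrow> V_quad m (root_vec i j) = 1"
  by (simp add: root_vec_def V_quad_add V_quad_basis V_form_basis flip: add.assoc)

lemma root_form: "i \<in> {1..m} \<Longrightarrow> j \<in> {1..m} \<Longrightarrow> k \<in> {1..m} \<Longrightarrow>
    V_form m (root_vec i j) (vec_v k) = (if i = k then 0 else 1) + (if j = k then 0 else 1)"
  by (simp add: root_vec_def V_form_add_left V_form_basis)

lemma form_u_root: "i \<in> {1..m} \<Longrightarrow> j \<in> {1..m} \<Longrightarrow> V_form m vec_u (root_vec i j) = 0"
  by (simp add: root_vec_def V_form_add_right V_form_u)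

lemma scale_zero: "Poly_Mapping.map ((*) 0) x = 0" for x :: "nat \<Rightarrow>\<^sub>0 laurent"
  by (rule poly_mapping_eqI) (simp add: Poly_Mapping.map.rep_eq when_def)

lemma scale_one: "Poly_Mapping.map ((*) 1) x = x" for x :: "nat \<Rightarrow>\<^sub>0 laurent"
  by (rule poly_mapping_eqI) (simp add: Poly_Mapping.map.rep_eq when_def)

text \<open>
  The form $(v_i + v_j, v_k)$ is $1$ exactly when $k$ is $i$ or $j$, and $v_i + (v_i + v_j) = v_j$ in
  characteristic $2$; so the reflection in $v_i + v_j$ permutes the $v_k$ as the transposition does.
\<close>

lemma root_permutes_basis:
  assumes "i \<in> {1..m}" "j \<in> {1..m}" "k \<in> {1..m}" "i \<noteq> j"
  shows "V_vec m (root_vec i j) \<cdot> V_vec m (vec_v k) \<cdot> V_vec m (root_vec i j) = V_vec m (vec_v (transpose i j k))"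
proof -
  have "vec_v k + Poly_Mapping.map ((*) (V_form m (root_vec i j) (vec_v k))) (root_vec i j) = vec_v (transpose i j k)"
  proof -
    consider "k = i" | "k = j" | "k \<noteq> i" "k \<noteq> j" by blast
    then show ?thesis
    proof cases
      case 1
      have "vec_v i + (vec_v i + vec_v j) = (vec_v j :: nat \<Rightarrow>\<^sub>0 laurent)"
        by (simp add: V_module_double flip: add.assoc)
      then show ?thesis using assms 1 by (simp add: root_form scale_one) (simp add: root_vec_def)
    next
      case 2
      have "vec_v j + (vec_v i + vec_v j) = vec_v i + (vec_v j + vec_v j :: nat \<Rightarrow>\<^sub>0 laurent)"
        by (simp only: ac_simps)
      then show ?thesis using assms 2 by (simp add: root_form scale_one) (simp add: root_vec_def V_module_double)
    next
      case 3
      then show ?thesis using assms by (simp add: root_form scale_zero)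
    qed
  qed
  then show ?thesis using assms reflection[OF root_mem[OF assms(1,2)] root_quad[OF assms(1,2,4)] vec_mem, of k] by simp
qed

lemma root_conj:
  assumes "i \<in> {1..m}" "j \<in> {1..m}" "k \<in> {1..m}" "l \<in> {1..m}" "i \<noteq> j"
  shows "V_vec m (root_vec i j) \<cdot> V_vec m (root_vec k l) \<cdot> V_vec m (root_vec i j) = V_vec m (root_vec (transpose i j k) (transpose i j l))"
proof -
  have mem: "vec_v k \<in> V_mod" "vec_v l \<in> V_mod" "vec_v (transpose i j k) \<in> V_mod" "vec_v (transpose i j l) \<in> V_mod"
    using assms by (auto intro!: vec_mem simp: transpose_def)
  note c = cl_vec_closed[OF root_mem[OF assms(1,2)], of "V_quad m"] mem[THEN cl_vec_closed, of "V_quad m"]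
  show ?thesis
    using c assms root_permutes_basis[OF assms(1,2) _ assms(5)]
    by (simp add: root_vec_def[of k l] root_vec_def[of "transpose i j k"] cl_vec_add mem Cl.l_distr Cl.r_distr)
qed

text \<open>
  The image of the transposition of $i$ and $j$. The factor $u$, which commutes with every root, is there
  because $s_i = \tau \tilde s_i$ with $\tau \mapsto u$. For $i = j$ the root is the zero vector, and the
  value has to be the identity instead.
\<close>

definition cl_swap :: "nat \<Rightarrow> nat \<Rightarrow> (nat tword \<Rightarrow>\<^sub>0 laurent) set"
  where "cl_swap i j = (if i = j then \<one>\<^bsub>V_Cl m\<^esub> else V_vec m 1 \<cdot> V_vec m (root_vec i j))"

lemma u_closed: "V_vec m 1 \<in> carrier (V_Cl m)"
  by (intro cl_vec_closed vec_u_mem)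

lemma u_square: "V_vec m 1 \<cdot> V_vec m 1 = \<one>\<^bsub>V_Cl m\<^esub>"
  by (intro unit_square vec_u_mem V_quad_u)

lemma u_cancel: "X \<in> carrier (V_Cl m) \<Longrightarrow> V_vec m 1 \<cdot> (V_vec m 1 \<cdot> X) = X"
  using u_closed by (simp add: u_square flip: Cl.m_assoc)

context
  fixes i j :: nat
  assumes ij: "i \<in> {1..m}" "j \<in> {1..m}"
begin

lemma cl_root_closed: "V_vec m (root_vec i j) \<in> carrier (V_Cl m)"
  by (intro cl_vec_closed root_mem ij)

lemma cl_root_u: "V_vec m (root_vec i j) \<cdot> V_vec m 1 = V_vec m 1 \<cdot> V_vec m (root_vec i j)"
  by (rule orthogonal_commute[symmetric, OF vec_u_mem root_mem[OF ij]]) (use form_u_root[OF ij] in simp)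

lemma cl_root_u_left: "X \<in> carrier (V_Cl m) \<Longrightarrow>
    V_vec m (root_vec i j) \<cdot> (V_vec m 1 \<cdot> X) = V_vec m 1 \<cdot> (V_vec m (root_vec i j) \<cdot> X)"
  using cl_root_closed u_closed by (simp add: cl_root_u flip: Cl.m_assoc)

lemma cl_root_square: "i \<noteq> j \<Longrightarrow> V_vec m (root_vec i j) \<cdot> V_vec m (root_vec i j) = \<one>\<^bsub>V_Cl m\<^esub>"
  by (intro unit_square root_mem root_quad ij)

lemma cl_swap_closed: "cl_swap i j \<in> carrier (V_Cl m)"
  using cl_root_closed u_closed by (simp add: cl_swap_def)

lemma cl_swap_square: "cl_swap i j \<cdot> cl_swap i j = \<one>\<^bsub>V_Cl m\<^esub>"
  using cl_root_closed u_closed by (simp add: cl_swap_def Cl.m_assoc cl_root_u_left cl_root_square u_square u_cancel)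

lemma cl_swap_Units: "cl_swap i j \<in> Units (V_Cl m)"
  unfolding Units_def using cl_swap_closed cl_swap_square by blast

lemma cl_swap_inv: "inv\<^bsub>V_Cl m\<^esub> cl_swap i j = cl_swap i j"
  using cl_swap_closed cl_swap_square by (intro Cl.inv_unique'[symmetric])

lemma cl_swap_commute: "cl_swap i j = cl_swap j i"
  by (simp add: cl_swap_def root_vec_def add.commute)

lemma u_cl_swap_u: "V_vec m 1 \<cdot> cl_swap i j \<cdot> V_vec m 1 = cl_swap i j"
  using cl_root_closed u_closed by (simp add: cl_swap_def Cl.m_assoc cl_root_u u_square u_cancel)

end

lemma cl_swap_conj:
  assumes ij: "i \<in> {1..m}" "j \<in> {1..m}" and kl: "k \<in> {1..m}" "l \<in> {1..m}"
  shows "cl_swap i j \<cdot> cl_swap k l \<cdot> cl_swap i j = cl_swap (transpose i j k) (transpose i j l)"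
proof -
  consider "i = j" | "i \<noteq> j" "k = l" | "i \<noteq> j" "k \<noteq> l" by blast
  then show ?thesis
  proof cases
    case 1
    then show ?thesis using cl_swap_closed[OF kl] by (simp add: cl_swap_def[of j j])
  next
    case 2
    then show ?thesis using cl_swap_closed[OF ij]
      by (simp add: cl_swap_def[of _ l] cl_swap_def[of "transpose i j l"] cl_swap_square[OF ij])
  next
    case 3
    let ?u = "V_vec m 1"
    have "cl_swap i j \<cdot> cl_swap k l \<cdot> cl_swap i j = ?u \<cdot> (V_vec m (root_vec i j) \<cdot> V_vec m (root_vec k l) \<cdot> V_vec m (root_vec i j))"
      using 3 u_closed cl_root_closed[OF ij] cl_root_closed[OF kl]
      by (simp add: cl_swap_def Cl.m_assoc cl_root_u_left[OF ij] cl_root_u_left[OF kl] u_cancel)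
    also have "\<dots> = cl_swap (transpose i j k) (transpose i j l)"
      using 3 by (simp add: root_conj[OF assms] cl_swap_def transpose_eq_iff) (metis transpose_involutory)
    finally show ?thesis .
  qed
qed

section \<open>The relations of $a$\<close>

text \<open>
  Scaling $v_1$ by $s$ makes it a unit vector: $q(s v_1) = s^2 t^{-1} = 1$.
\<close>

definition vec_sv1 :: "nat \<Rightarrow>\<^sub>0 laurent"
  where "vec_sv1 = Poly_Mapping.map ((*) (s_pow 1)) (vec_v 1)"

definition cl_a :: "(nat tword \<Rightarrow>\<^sub>0 laurent) set"
  where "cl_a = V_vec m 1 \<cdot> V_vec m vec_sv1"

context
  assumes m: "m \<ge> 2"
begin

lemma vec_sv1_mem: "vec_sv1 \<in> V_mod"
  using m unfolding vec_sv1_def by (intro free_module_scale vec_mem) auto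

lemma vec_sv1_quad: "V_quad m vec_sv1 = 1"
proof -
  have "V_quad m vec_sv1 = (s_pow 1)\<^sup>2 * V_quad m (vec_v 1)"
    unfolding vec_sv1_def by (rule V_quad_scale)
  also have "\<dots> = s_pow 1 * s_pow 1 * s_pow (- 2)"
    using m V_quad_basis[of 1 m] by (simp add: power2_eq_square)
  also have "\<dots> = 1" by (simp add: s_pow_def mult_single)
  finally show ?thesis .
qed

lemma v1_mem: "vec_v 1 \<in> V_mod"
  using m by (intro vec_mem) auto

lemma vec_sv1_vec: "V_vec m vec_sv1 = V_scal m (s_pow 1) \<cdot> V_vec m (vec_v 1)"
  unfolding vec_sv1_def by (rule cl_vec_scale[OF v1_mem])

lemma cl_a_eq: "cl_a = V_scal m (s_pow 1) \<cdot> V_vec m 1 \<cdot> V_vec m (vec_v 1)"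
proof -
  show ?thesis
    using u_closed cl_vec_closed[OF v1_mem, of "V_quad m"] cl_scal_closed[of "{0..m}" "V_quad m" "s_pow 1"]
      cl_scal_central[OF u_closed, of "s_pow 1"]
    by (simp add: cl_a_def vec_sv1_vec flip: Cl.m_assoc)
qed

lemma vec_sv1_closed: "V_vec m vec_sv1 \<in> carrier (V_Cl m)"
  by (intro cl_vec_closed vec_sv1_mem)

lemma vec_sv1_square: "V_vec m vec_sv1 \<cdot> V_vec m vec_sv1 = \<one>\<^bsub>V_Cl m\<^esub>"
  by (intro unit_square vec_sv1_mem vec_sv1_quad)

lemma vec_sv1_cancel: "X \<in> carrier (V_Cl m) \<Longrightarrow> V_vec m vec_sv1 \<cdot> (V_vec m vec_sv1 \<cdot> X) = X"
  using vec_sv1_closed by (simp add: vec_sv1_square flip: Cl.m_assoc)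

lemma vec_sv1_commute:
  assumes x: "x \<in> V_mod" and o: "V_form m x (vec_v 1) = 0"
  shows "V_vec m vec_sv1 \<cdot> V_vec m x = V_vec m x \<cdot> V_vec m vec_sv1"
proof -
  note c = cl_vec_closed[OF v1_mem, of "V_quad m"] cl_vec_closed[OF x, of "V_quad m"]
    cl_scal_closed[of "{0..m}" "V_quad m" "s_pow 1"]
  have "V_vec m vec_sv1 \<cdot> V_vec m x = V_scal m (s_pow 1) \<cdot> (V_vec m x \<cdot> V_vec m (vec_v 1))"
    using c orthogonal_commute[OF x v1_mem o] by (simp add: vec_sv1_vec Cl.m_assoc)
  also have "\<dots> = V_vec m x \<cdot> V_scal m (s_pow 1) \<cdot> V_vec m (vec_v 1)"
    using c cl_scal_central[OF c(2), of "s_pow 1"] by (simp flip: Cl.m_assoc)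
  finally show ?thesis using c by (simp add: vec_sv1_vec Cl.m_assoc)
qed

lemma cl_a_closed: "cl_a \<in> carrier (V_Cl m)"
  using u_closed vec_sv1_closed by (simp add: cl_a_def)

lemma cl_a_inv: "cl_a \<in> Units (V_Cl m)" "inv\<^bsub>V_Cl m\<^esub> cl_a = V_vec m vec_sv1 \<cdot> V_vec m 1"
proof -
  have *: "cl_a \<cdot> (V_vec m vec_sv1 \<cdot> V_vec m 1) = \<one>\<^bsub>V_Cl m\<^esub>" "(V_vec m vec_sv1 \<cdot> V_vec m 1) \<cdot> cl_a = \<one>\<^bsub>V_Cl m\<^esub>"
    using u_closed vec_sv1_closed by (simp_all add: cl_a_def Cl.m_assoc u_cancel vec_sv1_cancel u_square vec_sv1_square)
  have c: "V_vec m vec_sv1 \<cdot> V_vec m 1 \<in> carrier (V_Cl m)" using u_closed vec_sv1_closed by simp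
  show "cl_a \<in> Units (V_Cl m)" unfolding Units_def using cl_a_closed c * by blast
  show "inv\<^bsub>V_Cl m\<^esub> cl_a = V_vec m vec_sv1 \<cdot> V_vec m 1"
    using cl_a_closed c * by (intro Cl.inv_unique'[symmetric])
qed

lemma u_cl_a_u: "V_vec m 1 \<cdot> cl_a \<cdot> V_vec m 1 = inv\<^bsub>V_Cl m\<^esub> cl_a"
  unfolding cl_a_inv(2) using u_closed vec_sv1_closed by (simp add: cl_a_def Cl.m_assoc u_cancel)

text \<open>
  For $i \ge 2$ the root $v_i + v_{i+1}$ is orthogonal to $v_1$ and to $u$, so it commutes with the image
  of $a$ and cancels; what remains is conjugation by $u$.
\<close>

lemma cl_swap_cl_a:
  assumes i: "2 \<le> i" "i < m"
  shows "cl_swap i (Suc i) \<cdot> cl_a \<cdot> cl_swap i (Suc i) = inv\<^bsub>V_Cl m\<^esub> cl_a"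
proof -
  let ?E = "V_vec m (root_vec i (Suc i))"
  have ij: "i \<in> {1..m}" "Suc i \<in> {1..m}" and one: "1 \<in> {1..m}" using i m by auto
  note c = u_closed vec_sv1_closed cl_root_closed[OF ij]
  have Ev: "V_vec m vec_sv1 \<cdot> ?E = ?E \<cdot> V_vec m vec_sv1"
    using i root_form[OF ij one] by (intro vec_sv1_commute root_mem ij) auto
  have "cl_swap i (Suc i) \<cdot> cl_a \<cdot> cl_swap i (Suc i) = ?E \<cdot> (V_vec m vec_sv1 \<cdot> (V_vec m 1 \<cdot> ?E))"
    using c by (simp add: cl_swap_def cl_a_def Cl.m_assoc u_cancel cl_root_u_left[OF ij])
  also have "V_vec m 1 \<cdot> ?E = ?E \<cdot> V_vec m 1" by (rule cl_root_u[OF ij, symmetric])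
  also have "V_vec m vec_sv1 \<cdot> (?E \<cdot> V_vec m 1) = ?E \<cdot> (V_vec m vec_sv1 \<cdot> V_vec m 1)"
    using c Ev by (simp flip: Cl.m_assoc)
  also have "?E \<cdot> (?E \<cdot> (V_vec m vec_sv1 \<cdot> V_vec m 1)) = V_vec m vec_sv1 \<cdot> V_vec m 1"
    using c cl_root_square[OF ij] by (simp flip: Cl.m_assoc)
  finally show ?thesis by (simp only: cl_a_inv)
qed

text \<open>
  The vector $z = u + v_1 + v_2$ is the component of the root $v_1 + v_2$ orthogonal to
  $\langle u, v_1 \rangle$: on this plane the root and $u$ define the same linear form. It is singular,
  as $q(z) = q(u) + q(v_1 + v_2) = 0$, which makes $u (v_1 + v_2) = 1 + u z$ unipotent.
\<close>

lemma cl_swap_12_conjugates_commute: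
  assumes p: "p \<in> generate (units_of (V_Cl m)) {cl_a}"
  shows "cl_swap 1 2 \<cdot> (inv\<^bsub>V_Cl m\<^esub> p \<cdot> cl_swap 1 2 \<cdot> p) = (inv\<^bsub>V_Cl m\<^esub> p \<cdot> cl_swap 1 2 \<cdot> p) \<cdot> cl_swap 1 2"
proof -
  interpret K: group "units_of (V_Cl m)" by (rule Cl.units_group)
  have ij: "1 \<in> {1..m}" "2 \<in> {1..m}" using m by auto
  define z where "z = 1 + root_vec 1 2"
  have z: "z \<in> V_mod" unfolding z_def by (intro free_module_add vec_u_mem root_mem ij)
  let ?u = "V_vec m 1" and ?z = "V_vec m z"
  have zc: "?z \<in> carrier (V_Cl m)" by (rule cl_vec_closed[OF z])
  have z_u: "?u \<cdot> ?z = ?z \<cdot> ?u"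
    using V_form_basis[of 0 m 0] form_u_root[OF ij]
    by (intro orthogonal_commute vec_u_mem z) (simp add: z_def V_form_add_right)
  have "V_form m z (vec_v 1) = 0"
    using V_form_u[OF ij(1)] root_form[OF ij ij(1)] by (simp add: z_def V_form_add_left)
  then have z_v: "V_vec m vec_sv1 \<cdot> ?z = ?z \<cdot> V_vec m vec_sv1" by (rule vec_sv1_commute[OF z])
  have "V_quad m z = 0"
    using V_quad_u[of m] root_quad[OF ij] form_u_root[OF ij] by (simp add: z_def V_quad_add)
  then have zz: "?z \<cdot> ?z = \<zero>\<^bsub>V_Cl m\<^esub>"
    using cl_vec_square[OF z, of "V_quad m"] by (simp add: cl_scal_zero)
  have "root_vec 1 2 = 1 + z" by (simp add: z_def flip: add.assoc)
  then have "V_vec m (root_vec 1 2) = ?u \<boxplus> ?z" by (simp only: cl_vec_add vec_u_mem z)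
  then have sig: "cl_swap 1 2 = \<one>\<^bsub>V_Cl m\<^esub> \<boxplus> ?u \<cdot> ?z"
    using u_closed zc by (simp add: cl_swap_def Cl.r_distr u_square)
  have pU: "p \<in> Units (V_Cl m)"
    using p K.generate_incl[of "{cl_a}"] cl_a_inv by (auto simp: units_of_carrier)
  have "p \<cdot> ?z = ?z \<cdot> p" using p
  proof (induction rule: generate.induct)
    case one
    then show ?case using zc by (simp add: units_of_one)
  next
    case (incl h)
    then show ?case using zc u_closed vec_sv1_closed z_u
      by (simp add: cl_a_def Cl.m_assoc z_v) (simp flip: Cl.m_assoc)
  next
    case (inv h)
    then show ?case using zc u_closed vec_sv1_closed z_v
      by (simp add: Cl.units_of_inv cl_a_inv Cl.m_assoc z_u) (simp flip: Cl.m_assoc)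
  next
    case (eng c d)
    then have cd: "c \<in> carrier (V_Cl m)" "d \<in> carrier (V_Cl m)"
      using K.generate_incl[of "{cl_a}"] cl_a_inv by (auto simp: units_of_carrier)
    have "c \<cdot> d \<cdot> ?z = c \<cdot> ?z \<cdot> d" using cd zc eng.IH(2) by (simp add: Cl.m_assoc)
    also have "\<dots> = ?z \<cdot> (c \<cdot> d)" using cd zc eng.IH(1) by (simp add: Cl.m_assoc)
    finally show ?case by (simp add: units_of_mult)
  qed
  then show ?thesis unfolding sig
    by (intro Cl.unipotent_conjugates_commute pU u_closed zc zz z_u)
qed

section \<open>The homomorphism to the Pin group\<close>

lemma yt_hom_to_clifford_units:
  obtains \<psi> where "\<psi> \<in> hom (yt_group m) (units_of (V_Cl m))"
    "\<psi> (yt_tau m) = V_vec m 1" "\<psi> (yt_a m) = cl_a"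
    "\<And>i. 1 \<le> i \<Longrightarrow> i < m \<Longrightarrow> \<psi> (yt_s m i) = cl_swap i (Suc i)"
proof -
  let ?K = "units_of (V_Cl m)"
  interpret K: group ?K by (rule Cl.units_group)
  note K_simps = units_of_carrier units_of_mult units_of_one
  have u: "V_vec m 1 \<in> carrier ?K"
    by (simp only: units_of_carrier unit_vector_Units[OF vec_u_mem V_quad_u])
  have uu: "V_vec m 1 \<otimes>\<^bsub>?K\<^esub> V_vec m 1 = \<one>\<^bsub>?K\<^esub>" by (simp only: K_simps u_square)
  have \<alpha>: "cl_a \<in> carrier ?K" by (simp only: units_of_carrier cl_a_inv)
  have sig: "cl_swap i j \<in> carrier ?K" if "i \<in> {1..m}" "j \<in> {1..m}" for i j
    by (simp only: units_of_carrier cl_swap_Units[OF that])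
  obtain \<Phi> where \<Phi>: "\<Phi> \<in> hom (sym_group m) ?K"
    and \<Phi>_swap: "\<And>i j. i \<in> {1..m} \<Longrightarrow> j \<in> {1..m} \<Longrightarrow> \<Phi> (transpose i j) = cl_swap i j"
  proof (rule K.sym_group_hom_of_transpositions[of m cl_swap])
    show "cl_swap i j \<otimes>\<^bsub>?K\<^esub> cl_swap k l \<otimes>\<^bsub>?K\<^esub> cl_swap i j = cl_swap (transpose i j k) (transpose i j l)"
      if "i \<in> {1..m}" "j \<in> {1..m}" "k \<in> {1..m}" "l \<in> {1..m}" for i j k l
      by (simp only: units_of_mult cl_swap_conj[OF that])
    show "cl_swap i i = \<one>\<^bsub>?K\<^esub>" for i by (simp add: cl_swap_def K_simps)
    show "cl_swap i j \<otimes>\<^bsub>?K\<^esub> cl_swap i j = \<one>\<^bsub>?K\<^esub>" if "i \<in> {1..m}" "j \<in> {1..m}" for i j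
      by (simp only: K_simps cl_swap_square[OF that])
    show "cl_swap i j \<in> carrier ?K" if "i \<in> {1..m}" "j \<in> {1..m}" for i j by (rule sig[OF that])
    show "cl_swap i j = cl_swap j i" if "i \<in> {1..m}" "j \<in> {1..m}" for i j by (rule cl_swap_commute[OF that])
  qed blast
  have adj: "\<Phi> (transpose i (Suc i)) = cl_swap i (Suc i)" if "1 \<le> i" "i < m" for i
    using that by (intro \<Phi>_swap) auto
  \<comment> \<open>Conjugation by $u$ fixes the images of the $s_i$, and these determine \<open>\<Phi>\<close>.\<close>
  have u\<Phi>: "V_vec m 1 \<otimes>\<^bsub>?K\<^esub> \<Phi> p \<otimes>\<^bsub>?K\<^esub> V_vec m 1 = \<Phi> p" if "p permutes {1..m}" for p
  proof (rule homs_agree_on_generate[OF sym_group_is_group' K.is_group _ \<Phi>,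
        where f = "\<lambda>p. V_vec m 1 \<otimes>\<^bsub>?K\<^esub> \<Phi> p \<otimes>\<^bsub>?K\<^esub> V_vec m 1"])
    let ?A = "{transpose i (Suc i) | i :: nat. 1 \<le> i \<and> i < m}"
    have "V_vec m 1 \<otimes>\<^bsub>?K\<^esub> (V_vec m 1 \<otimes>\<^bsub>?K\<^esub> X) = X" if "X \<in> carrier ?K" for X
      using that u uu by (simp flip: K.m_assoc)
    then show "(\<lambda>p. V_vec m 1 \<otimes>\<^bsub>?K\<^esub> \<Phi> p \<otimes>\<^bsub>?K\<^esub> V_vec m 1) \<in> hom (sym_group m) ?K"
      using u hom_in_carrier[OF \<Phi>] by (intro homI) (simp_all add: hom_mult[OF \<Phi>] K.m_assoc)
    show "p \<in> generate (sym_group m) ?A"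
      using that by (simp only: sym_group_carrier flip: sym_group_generated_by_adjacent_transpositions)
    show "?A \<subseteq> carrier (sym_group m)"
      by (auto simp: sym_group_carrier intro!: permutes_swap_id)
    show "V_vec m 1 \<otimes>\<^bsub>?K\<^esub> \<Phi> x \<otimes>\<^bsub>?K\<^esub> V_vec m 1 = \<Phi> x" if "x \<in> ?A" for x
    proof -
      obtain i where i: "x = transpose i (Suc i)" "i \<in> {1..m}" "Suc i \<in> {1..m}"
        using \<open>x \<in> ?A\<close> by auto
      then show ?thesis by (simp only: \<Phi>_swap units_of_mult u_cl_swap_u)
    qed
  qed
  show thesis
  proof (rule K.yt_group_lift[OF m \<alpha> u uu _ \<Phi> u\<Phi>])
    show "V_vec m 1 \<otimes>\<^bsub>?K\<^esub> cl_a \<otimes>\<^bsub>?K\<^esub> V_vec m 1 = inv\<^bsub>?K\<^esub> cl_a"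
      by (simp only: units_of_mult Cl.units_of_inv cl_a_inv(1) u_cl_a_u)
    show "commutator ?K (\<Phi> (transpose 1 2)) (conjg ?K (\<Phi> (transpose 1 2)) (cl_a [^]\<^bsub>?K\<^esub> k)) = \<one>\<^bsub>?K\<^esub>"
      for k :: int
    proof -
      let ?p = "cl_a [^]\<^bsub>?K\<^esub> k"
      have s: "\<Phi> (transpose 1 2) = cl_swap 1 2" "cl_swap 1 2 \<in> carrier ?K"
        using m by (auto intro!: \<Phi>_swap sig)
      have p: "?p \<in> carrier ?K" by (rule K.int_pow_closed[OF \<alpha>])
      have "?p \<in> generate ?K {cl_a}" using K.generate_pow[OF \<alpha>] by blast
      from cl_swap_12_conjugates_commute[OF this]
      have "cl_swap 1 2 \<otimes>\<^bsub>?K\<^esub> conjg ?K (cl_swap 1 2) ?p = conjg ?K (cl_swap 1 2) ?p \<otimes>\<^bsub>?K\<^esub> cl_swap 1 2"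
        using p by (simp only: conjg_def units_of_mult units_of_carrier Cl.units_of_inv)
      then show ?thesis unfolding s(1)
        using p s(2) by (intro K.commutator_eq_one) (simp_all add: conjg_def)
    qed
    show "conjg ?K cl_a (\<Phi> (transpose i (Suc i))) = inv\<^bsub>?K\<^esub> cl_a" if i: "2 \<le> i" "i < m" for i
    proof -
      have ij: "i \<in> {1..m}" "Suc i \<in> {1..m}" using i by auto
      show ?thesis
        by (simp only: conjg_def units_of_mult Cl.units_of_inv cl_swap_Units[OF ij] cl_a_inv(1)
            \<Phi>_swap[OF ij] cl_swap_inv[OF ij] cl_swap_cl_a[OF i])
    qed
  qed (use that adj in auto)
qed

end
end

theorem proposition3p16:
  fixes m :: nat
  assumes "m \<ge> 2"
  shows "\<exists>!\<psi>. \<psi> \<in> hom (yt_group m) (V_Pin m) \<and> \<psi> \<in> extensional (carrier (yt_group m))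
    \<and> \<psi> (yt_tau m) = V_vec m vec_u
    \<and> \<psi> (yt_a m) = V_scal m (s_pow 1) \<otimes>\<^bsub>V_Cl m\<^esub> V_vec m vec_u \<otimes>\<^bsub>V_Cl m\<^esub> V_vec m (vec_v 1)
    \<and> (\<forall>i\<in>{1..m - 1}. \<psi> (yt_st m i) = V_vec m (vec_v i + vec_v (Suc i)))"
proof -
  let ?G = "yt_group m" and ?K = "units_of (V_Cl m)"
  let ?X = "{yt_tau m, yt_a m} \<union> {yt_st m i | i. 1 \<le> i \<and> i < m}"
  interpret Cl: ring "V_Cl m" by (rule clifford_algebra_ring)
  interpret G: group ?G by (rule yt_group_group[OF assms])
  interpret K: group ?K by (rule Cl.units_group)
  note gen = yt_group_generated[OF assms]
  have tauG: "yt_tau m \<in> carrier ?G" and aG: "yt_a m \<in> carrier ?G" using gen(2) by auto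
  have stG: "yt_st m i \<in> carrier ?G" if "1 \<le> i" "i < m" for i using that gen(2) by blast
  obtain \<psi> where \<psi>: "\<psi> \<in> hom ?G ?K" and \<tau>: "\<psi> (yt_tau m) = V_vec m 1" and a: "\<psi> (yt_a m) = cl_a m"
    and s: "\<And>i. 1 \<le> i \<Longrightarrow> i < m \<Longrightarrow> \<psi> (yt_s m i) = cl_swap m i (Suc i)"
    using yt_hom_to_clifford_units[OF assms] by metis
  interpret \<psi>: group_hom ?G ?K \<psi> using \<psi> by unfold_locales
  have st: "\<psi> (yt_st m i) = V_vec m (root_vec i (Suc i))" if i: "1 \<le> i" "i < m" for i
  proof -
    have ij: "i \<in> {1..m}" "Suc i \<in> {1..m}" using i by auto
    have "\<psi> (yt_st m i) = V_vec m 1 \<otimes>\<^bsub>V_Cl m\<^esub> cl_swap m i (Suc i)"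
      unfolding yt_st_def \<psi>.hom_mult[OF tauG yt_s_closed[OF i]] by (simp only: \<tau> s[OF i] units_of_mult)
    then show ?thesis using cl_root_closed[OF ij] by (simp add: cl_swap_def u_cancel)
  qed
  have U: "unit_vectors m \<subseteq> carrier ?K"
    by (auto simp: unit_vectors_def units_of_carrier unit_vector_Units)
  have "\<psi> ` ?X \<subseteq> generate ?K (unit_vectors m)"
  proof -
    have "V_vec m 1 \<in> generate ?K (unit_vectors m)" "V_vec m vec_sv1 \<in> generate ?K (unit_vectors m)"
      by (auto simp: unit_vectors_def intro!: generate.incl imageI vec_u_mem V_quad_u vec_sv1_mem vec_sv1_quad assms)
    moreover from this have "cl_a m \<in> generate ?K (unit_vectors m)"
      using generate.eng[of _ ?K] by (simp add: cl_a_def units_of_mult)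
    moreover have "V_vec m (root_vec i (Suc i)) \<in> generate ?K (unit_vectors m)" if "1 \<le> i" "i < m" for i
      using that by (auto simp: unit_vectors_def intro!: generate.incl imageI root_mem root_quad)
    ultimately show ?thesis by (auto simp: \<tau> a st)
  qed
  then have "\<psi> ` carrier ?G \<subseteq> generate ?K (unit_vectors m)"
    unfolding gen(1) \<psi>.generate_img[OF gen(2), symmetric]
    by (intro K.generate_subgroup_incl K.generate_is_subgroup U)
  then have pin: "\<psi> x \<in> pin_set {0..m} (V_quad m)" if "x \<in> carrier ?G" for x
    using that generate_unit_vectors_pin[of m] by blast
  let ?\<psi> = "restrict \<psi> (carrier ?G)"
  have pin_hom: "f \<in> hom ?G (V_Pin m) \<longleftrightarrow> f \<in> hom ?G ?K \<and> f ` carrier ?G \<subseteq> pin_set {0..m} (V_quad m)" for f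
    by (auto simp: hom_def pin_group_def units_of_def pin_set_def clifford_group_set_def)
  show ?thesis
  proof (rule ex1I[of _ ?\<psi>], intro conjI ballI)
    show "?\<psi> \<in> hom ?G (V_Pin m)"
      using \<psi> pin unfolding pin_hom by (auto simp: hom_def)
    show "?\<psi> \<in> extensional (carrier ?G)" by simp
    show "?\<psi> (yt_tau m) = V_vec m vec_u" using tauG \<tau> by simp
    show "?\<psi> (yt_a m) = V_scal m (s_pow 1) \<otimes>\<^bsub>V_Cl m\<^esub> V_vec m vec_u \<otimes>\<^bsub>V_Cl m\<^esub> V_vec m (vec_v 1)"
      using aG a cl_a_eq[OF assms] by simp
    show "?\<psi> (yt_st m i) = V_vec m (vec_v i + vec_v (Suc i))" if "i \<in> {1..m - 1}" for i
    proof -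
      have i: "1 \<le> i" "i < m" using that assms by auto
      then show ?thesis using stG[OF i] st[OF i] by (simp add: root_vec_def)
    qed
  next
    fix f
    assume f: "f \<in> hom ?G (V_Pin m) \<and> f \<in> extensional (carrier ?G)
      \<and> f (yt_tau m) = V_vec m vec_u
      \<and> f (yt_a m) = V_scal m (s_pow 1) \<otimes>\<^bsub>V_Cl m\<^esub> V_vec m vec_u \<otimes>\<^bsub>V_Cl m\<^esub> V_vec m (vec_v 1)
      \<and> (\<forall>i\<in>{1..m - 1}. f (yt_st m i) = V_vec m (vec_v i + vec_v (Suc i)))"
    have "f x = \<psi> x" if "x \<in> carrier ?G" for x
    proof (rule homs_agree_on_generate[OF G.is_group K.is_group _ \<psi> gen(2)])
      show "f \<in> hom ?G ?K" using f unfolding pin_hom by blast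
      show "x \<in> generate ?G ?X" using that unfolding gen(1) .
      fix y assume "y \<in> ?X"
      then consider "y = yt_tau m" | "y = yt_a m" | i where "y = yt_st m i" "1 \<le> i" "i < m" by blast
      then show "f y = \<psi> y"
      proof cases
        case 1
        then show ?thesis using f \<tau> by simp
      next
        case 2
        then show ?thesis using f a cl_a_eq[OF assms] by simp
      next
        case (3 i)
        then have "i \<in> {1..m - 1}" by auto
        then show ?thesis using f st[OF 3(2,3)] by (simp only: 3(1) root_vec_def)
      qed
    qed
    then show "f = ?\<psi>" using f by (intro extensionalityI[of _ "carrier ?G"]) auto
  qed
qed

end
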